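(* Suppose there is a scalar $G>0$ such that for every $i$, $\|\nabla F_i(x,\xi_i)\|\le G$ almost surely for all $x\in\mathbb{R}^d$; and suppose that the graph $\mathcal{G}$ is connected, $A$ is doubly stochastic, and $\rho_A=\rho\big(A-\frac{\mathbf{1}_n\mathbf{1}_n'}{n}\big)<1$. Then the iterates of the algorithm (described in the context) satisfy, for every $T\ge1$, $$\sum_{t=1}^T\mathbb{E}\big[\|\boldsymbol v_t-\tilde{\boldsymbol v}_t\|^2\big]\le\frac{36G^2}{(1-\rho_A)^2}\sum_{t=1}^T\mathbb{E}\big[\|\boldsymbol s_t-\tilde{\boldsymbol s}_t\|^2\big]+\frac{2}{1-\beta_2^2}\Delta_2,$$ where $\Delta_2=\mathbb{E}\|\boldsymbol v_1-\tilde{\boldsymbol v}_1\|^2$.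
   Context: Problem. Let $n,d\ge1$. Nodes $\mathcal{V}=\{1,\dots,n\}$ communicate over an undirected graph $\mathcal{G}=(\mathcal{V},\mathcal{E},A)$ with weighted adjacency matrix $A=[A_{ij}]\in\mathbb{R}^{n\times n}$. Node $i$ has local cost $f_i(x)=\mathbb{E}_{\xi_i}[F_i(x,\xi_i)]$, $x\in\mathbb{R}^d$, where $\xi_i$ is a random variable. $\nabla F_i(x,\xi_i)$ is the gradient in $x$. $\rho(\cdot)$ is the spectral radius, $\odot$ the entrywise product, $\otimes$ the Kronecker product, $\mathbf{1}_n$ the all-ones vector, $\|\cdot\|$ the Euclidean norm. Algorithm (GT-based distributed adaptive gradient algorithm). Parameters: $\beta_1,\beta_2\in(0,1)$, $\alpha>0$, $v_{\max}\ge1\ge v_{\min}>0$. Write $g_{t,i}=\nabla F_i(x_{t,i},\xi_{t,i})$, where $\xi_{t,i}$ is the sample of $\xi_i$ drawn at iteration $t$ from its local distribution, independently of the past (so of $x_{t,i}$). Initialization: arbitrary deterministic $x_{1,i}\in\mathbb{R}^d$, $s_{1,i}=g_{1,i}$, $m_{1,i}=0$, $v_{1,i}=s_{1,i}\odot s_{1,i}$. For $t\ge1$ and every $i$: $m_{t+1,i}=\beta_1m_{t,i}+(1-\beta_1)s_{t,i}$; $\hat v_{t+1,i}=\beta_2v_{t,i}+(1-\beta_2)s_{t,i}\odot s_{t,i}$; $v_{t+1,i}=\max\{\min\{\hat v_{t+1,i},v_{\max}\},v_{\min}\}$ (entrywise); $V_{t+1,i}=\mathrm{diag}\{[v_{t+1,i}]_1,\dots,[v_{t+1,i}]_d\}$;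 $x_{t+1,i}=\sum_{j=1}^nA_{ij}x_{t,j}-\alpha V_{t+1,i}^{-1/2}m_{t+1,i}$; $s_{t+1,i}=\sum_{j=1}^nA_{ij}s_{t,j}+g_{t+1,i}-g_{t,i}$. Notation. For $\zeta\in\{v,s\}$: $\boldsymbol\zeta_t=[\zeta_{t,1}',\dots,\zeta_{t,n}']'\in\mathbb{R}^{nd}$, $\bar\zeta_t=\frac1n\sum_i\zeta_{t,i}$, $\tilde{\boldsymbol\zeta}_t=\mathbf{1}_n\otimes\bar\zeta_t$. *)

theory Defs
  imports "HOL-Probability.Probability" "Jordan_Normal_Form.Spectral_Radius"
begin

no_notation vec_index (infixl \<open>$\<close> 100)
hide_const (open) Matrix.vec Matrix.mat Matrix.row Determinant.det

text \<open>
  The nodes are the elements of a finite type \<open>'n\<close>; a local variable is a vector in \<open>real ^ 'd\<close>, and a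
  stacked vector of dimension \<open>n d\<close> has type \<open>real ^ 'd ^ 'n\<close>, whose norm is the Euclidean norm of all
  \<open>n d\<close> entries.
\<close>

subsection \<open>Communication graph\<close>

text \<open>
  The edge set is a symmetric relation. Diagonal weights are not tied to the edge set, so that
  nodes may keep a positive self-weight whether or not self-loops are counted as edges.
\<close>

definition weighted_adjacency :: "'n rel \<Rightarrow> real ^ 'n ^ 'n \<Rightarrow> bool" where
  "weighted_adjacency E A \<longleftrightarrow> sym E \<and> transpose A = A \<and>
     (\<forall>i j. i \<noteq> j \<longrightarrow> ((i, j) \<in> E \<longleftrightarrow> A $ i $ j \<noteq> 0))"

definition connected_graph :: "'n rel \<Rightarrow> bool" where
  "connected_graph E \<longleftrightarrow> (\<forall>i j. (i, j) \<in> E\<^sup>*)"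

definition doubly_stochastic :: "real ^ 'n ^ 'n \<Rightarrow> bool" where
  "doubly_stochastic A \<longleftrightarrow> (\<forall>i j. A $ i $ j \<ge> 0) \<and>
     (\<forall>i. (\<Sum>j\<in>UNIV. A $ i $ j) = 1) \<and> (\<forall>j. (\<Sum>i\<in>UNIV. A $ i $ j) = 1)"

definition averaging_matrix :: "real ^ 'n ^ 'n" where
  "averaging_matrix = (\<chi> i j. 1 / real CARD('n))"

text \<open>
  The spectral radius from the library is defined for complex matrices with indices \<open>0, ..., n - 1\<close>.
  The enumeration of \<open>'n\<close> used here is irrelevant: another one conjugates the matrix by a permutation
  and leaves the spectrum unchanged.
\<close>

definition complex_mat_of :: "real ^ 'n ^ 'n \<Rightarrow> complex Matrix.mat" where
  "complex_mat_of B = Matrix.mat CARD('n) CARD('n)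
     (\<lambda>(k, l). complex_of_real (B $ from_nat_into UNIV k $ from_nat_into UNIV l))"

definition matrix_spectral_radius :: "real ^ 'n ^ 'n \<Rightarrow> real" where
  "matrix_spectral_radius B = spectral_radius (complex_mat_of B)"

subsection \<open>Stochastic costs and samples\<close>

text \<open>
  \<open>D i\<close> is the law of the random variable of node \<open>i\<close>, \<open>F i y z\<close> its stochastic cost at \<open>y\<close> for the
  realisation \<open>z\<close>, \<open>f i\<close> its local cost and \<open>dF i y z\<close> the gradient of \<open>F i\<close> in \<open>y\<close>.
\<close>

definition stochastic_costs ::
  "('n \<Rightarrow> 'b measure) \<Rightarrow> ('n \<Rightarrow> real ^ 'd \<Rightarrow> 'b \<Rightarrow> real) \<Rightarrow> ('n \<Rightarrow> real ^ 'd \<Rightarrow> real) \<Rightarrow>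
   ('n \<Rightarrow> real ^ 'd \<Rightarrow> 'b \<Rightarrow> real ^ 'd) \<Rightarrow> bool" where
  "stochastic_costs D F f dF \<longleftrightarrow>
     (\<forall>i. prob_space (D i)) \<and>
     (\<forall>i y. has_bochner_integral (D i) (F i y) (f i y)) \<and>
     (\<forall>i y. \<forall>z\<in>space (D i). GDERIV (\<lambda>y'. F i y' z) y :> dF i y z)"

text \<open>
  Each sample \<open>\<xi> t i\<close> is independent of the joint past \<open>\<xi> s j\<close>, \<open>1 \<le> s < t\<close>. Samples drawn at the same
  time by different nodes may be dependent.
\<close>

definition fresh_samples ::
  "'a measure \<Rightarrow> ('n \<Rightarrow> 'b measure) \<Rightarrow> (nat \<Rightarrow> 'n \<Rightarrow> 'a \<Rightarrow> 'b) \<Rightarrow> bool" where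
  "fresh_samples M D \<xi> \<longleftrightarrow> (\<forall>t\<ge>1. \<forall>i.
     \<xi> t i \<in> measurable M (D i) \<and> distr M (D i) (\<xi> t i) = D i \<and>
     prob_space.indep_set M
       (sets (vimage_algebra (space M) (\<xi> t i) (D i)))
       (sets (vimage_algebra (space M) (\<lambda>\<omega>. \<lambda>(s, j) \<in> {1..<t} \<times> UNIV. \<xi> s j \<omega>)
                (\<Pi>\<^sub>M (s, j) \<in> {1..<t} \<times> UNIV. D j))))"

subsection \<open>The algorithm\<close>

definition clip :: "real \<Rightarrow> real \<Rightarrow> real ^ 'd \<Rightarrow> real ^ 'd" where
  "clip lo hi w = (\<chi> k. max (min (w $ k) hi) lo)"

definition diag_matrix :: "real ^ 'd \<Rightarrow> real ^ 'd ^ 'd" where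
  "diag_matrix w = (\<chi> k l. if k = l then w $ k else 0)"

definition diag_inv_sqrt :: "real ^ 'd \<Rightarrow> real ^ 'd ^ 'd" where
  "diag_inv_sqrt w = diag_matrix (\<chi> k. (w $ k) powr (- 1 / 2))"

text \<open>
  One sample path of the iterates, for \<open>t \<ge> 1\<close>; values at \<open>t = 0\<close> are unconstrained.
  \<open>h t i y\<close> is the gradient that node \<open>i\<close> observes at time \<open>t\<close> when it queries the point \<open>y\<close>.
  The product \<open>*\<close> on \<open>real ^ 'd\<close> is entrywise.
\<close>

definition gt_adaptive_iterates ::
  "real ^ 'n ^ 'n \<Rightarrow> real \<Rightarrow> real \<Rightarrow> real \<Rightarrow> real \<Rightarrow> real \<Rightarrow> ('n \<Rightarrow> real ^ 'd) \<Rightarrow>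
   (nat \<Rightarrow> 'n \<Rightarrow> real ^ 'd \<Rightarrow> real ^ 'd) \<Rightarrow>
   (nat \<Rightarrow> 'n \<Rightarrow> real ^ 'd) \<Rightarrow> (nat \<Rightarrow> 'n \<Rightarrow> real ^ 'd) \<Rightarrow>
   (nat \<Rightarrow> 'n \<Rightarrow> real ^ 'd) \<Rightarrow> (nat \<Rightarrow> 'n \<Rightarrow> real ^ 'd) \<Rightarrow> bool" where
  "gt_adaptive_iterates A \<alpha> \<beta>1 \<beta>2 vmin vmax x1 h x m v s \<longleftrightarrow>
     (\<forall>i. x 1 i = x1 i \<and> s 1 i = h 1 i (x 1 i) \<and> m 1 i = 0 \<and> v 1 i = s 1 i * s 1 i) \<and>
     (\<forall>t\<ge>1. \<forall>i.
        m (t + 1) i = \<beta>1 *\<^sub>R m t i + (1 - \<beta>1) *\<^sub>R s t i \<and>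
        v (t + 1) i = clip vmin vmax (\<beta>2 *\<^sub>R v t i + (1 - \<beta>2) *\<^sub>R (s t i * s t i)) \<and>
        x (t + 1) i = (\<Sum>j\<in>UNIV. A $ i $ j *\<^sub>R x t j)
                      - \<alpha> *\<^sub>R (diag_inv_sqrt (v (t + 1) i) *v m (t + 1) i) \<and>
        s (t + 1) i = (\<Sum>j\<in>UNIV. A $ i $ j *\<^sub>R s t j)
                      + h (t + 1) i (x (t + 1) i) - h t i (x t i))"

subsection \<open>Stacked vectors\<close>

definition stack :: "('n \<Rightarrow> real ^ 'd) \<Rightarrow> real ^ 'd ^ 'n" where
  "stack w = (\<chi> i. w i)"

definition node_average :: "('n \<Rightarrow> real ^ 'd) \<Rightarrow> real ^ 'd" where
  "node_average w = (1 / real CARD('n)) *\<^sub>R (\<Sum>i\<in>UNIV. w i)"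

definition stacked_average :: "('n \<Rightarrow> real ^ 'd) \<Rightarrow> real ^ 'd ^ 'n" where
  "stacked_average w = stack (\<lambda>_. node_average w)"

end

theory Submission
  imports Defs
begin

text \<open>
  Work on one sample path and one coordinate, scaled so that \<open>G = 1\<close>. Clipping does not increase the
  deviation from the mean and \<open>v\<close> is an exponential average of \<open>s \<odot> s\<close>, so it suffices to bound
  the deviations of \<open>s\<^sup>2\<close> by those of \<open>s\<close>. No entrywise bound on \<open>s\<close> of order
  \<open>1 / (1 - \<rho>)\<close> that is uniform in \<open>n\<close> is available; instead one controls fourth moments of the excess
  \<open>w = max (\<bar>s\<bar> - 1) 0\<close>. It satisfies \<open>w\<^sub>1 = 0\<close> and \<open>w\<^bsub>t+1\<^esub> \<le> A w\<^sub>t + 2\<close>, while Jensen's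
  inequality and the spectral gap applied to \<open>w\<^sup>2\<close> give
  \<open>\<Sum>(A w)\<^sup>4 \<le> \<rho>\<^sup>2 \<Sum>w\<^sup>4 + (1 - \<rho>\<^sup>2) K \<Sum>w\<^sup>2\<close> with \<open>K = ((1 + \<rho>) / (1 - \<rho>))\<^sup>2\<close>. A pointwise
  quartic inequality turns this into \<open>\<Sum>w\<^sup>4 \<le> b\<^sup>2 \<Sum>w\<^sup>2\<close>, summed over time and nodes, with
  \<open>b = 6 / (1 - \<rho>) - 2\<close>.

  On the probabilistic side, a gradient bounded almost surely at each fixed point is almost surely bounded
  at all points simultaneously: Fubini and the fundamental theorem of calculus on segments give a
  Lipschitz bound between points of a countable dense set. Hence the gradients at the random iterates are
  bounded almost surely, whatever their dependence on the samples.
\<close>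

subsection \<open>Deviation from the mean\<close>

definition avg :: "('n::finite \<Rightarrow> real) \<Rightarrow> real" where
  "avg x = (\<Sum>i\<in>UNIV. x i) / real CARD('n)"

text \<open>This is n times the variance. Without the factor 1/n, the sum over coordinates is the
  squared norm of the stacked deviation.\<close>

definition deviation :: "('n::finite \<Rightarrow> real) \<Rightarrow> real" where
  "deviation x = (\<Sum>i\<in>UNIV. (x i - avg x)\<^sup>2)"

lemma sum_eq_avg: "(\<Sum>i\<in>UNIV. x i) = real CARD('n) * avg x" for x :: "'n::finite \<Rightarrow> real"
  by (simp add: avg_def)

lemma sum_minus_avg [simp]: "(\<Sum>i\<in>UNIV. x i - avg x) = 0" for x :: "'n::finite \<Rightarrow> real"
  by (simp add: sum_subtractf sum_eq_avg)

text \<open>Steiner's identity: the cross term vanishes because the deviations from the mean sum to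
  zero.\<close>

lemma sum_sq_diff_eq:
  fixes x :: "'n::finite \<Rightarrow> real"
  shows "(\<Sum>i\<in>UNIV. (x i - c)\<^sup>2) = deviation x + real CARD('n) * (avg x - c)\<^sup>2"
proof -
  have "(\<Sum>i\<in>UNIV. (x i - c)\<^sup>2)
      = (\<Sum>i\<in>UNIV. (x i - avg x)\<^sup>2 + 2 * (avg x - c) * (x i - avg x) + (avg x - c)\<^sup>2)"
    by (rule sum.cong) (auto simp: power2_eq_square algebra_simps)
  also have "\<dots> = deviation x + 2 * (avg x - c) * (\<Sum>i\<in>UNIV. x i - avg x)
                  + real CARD('n) * (avg x - c)\<^sup>2"
    by (simp only: sum.distrib sum_distrib_left deviation_def) simp
  finally show ?thesis by simp
qed

text \<open>The mean is the least-squares constant. Any convenient \<open>c\<close> therefore bounds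
  a deviation, and the mean of a transformed family never has to be computed.\<close>

lemma deviation_le: "deviation x \<le> (\<Sum>i\<in>UNIV. (x i - c)\<^sup>2)"
  by (simp add: sum_sq_diff_eq)

lemma sum_sq_eq: "(\<Sum>i\<in>UNIV. (x i)\<^sup>2) = deviation x + real CARD('n) * (avg x)\<^sup>2"
  for x :: "'n::finite \<Rightarrow> real"
  using sum_sq_diff_eq[of x 0] by simp

lemma deviation_nonneg: "0 \<le> deviation x"
  by (simp add: deviation_def sum_nonneg)

lemma avg_scale: "avg (\<lambda>i. c * x i) = c * avg x"
  by (simp add: avg_def flip: sum_distrib_left)

lemma deviation_scale: "deviation (\<lambda>i. c * x i) = c\<^sup>2 * deviation x"
  by (simp add: deviation_def avg_scale power_mult_distrib sum_distrib_left flip: right_diff_distrib)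

lemma deviation_convex:
  fixes x y :: "'n::finite \<Rightarrow> real"
  assumes "0 \<le> \<beta>" "\<beta> \<le> 1"
  shows "deviation (\<lambda>i. \<beta> * x i + (1 - \<beta>) * y i) \<le> \<beta> * deviation x + (1 - \<beta>) * deviation y"
proof -
  have conv: "(\<beta> * a + (1 - \<beta>) * c)\<^sup>2 \<le> \<beta> * a\<^sup>2 + (1 - \<beta>) * c\<^sup>2" for a c :: real
  proof -
    have "\<beta> * a\<^sup>2 + (1 - \<beta>) * c\<^sup>2 - (\<beta> * a + (1 - \<beta>) * c)\<^sup>2 = \<beta> * (1 - \<beta>) * (a - c)\<^sup>2"
      by (simp add: power2_eq_square algebra_simps)
    also have "\<dots> \<ge> 0" using assms by simp
    finally show ?thesis by simp
  qed
  have "deviation (\<lambda>i. \<beta> * x i + (1 - \<beta>) * y i)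
      \<le> (\<Sum>i\<in>UNIV. (\<beta> * x i + (1 - \<beta>) * y i - (\<beta> * avg x + (1 - \<beta>) * avg y))\<^sup>2)"
    by (rule deviation_le)
  also have "\<dots> = (\<Sum>i\<in>UNIV. (\<beta> * (x i - avg x) + (1 - \<beta>) * (y i - avg y))\<^sup>2)"
    by (simp add: algebra_simps)
  also have "\<dots> \<le> (\<Sum>i\<in>UNIV. \<beta> * (x i - avg x)\<^sup>2 + (1 - \<beta>) * (y i - avg y)\<^sup>2)"
    by (rule sum_mono) (rule conv)
  finally show ?thesis by (simp add: sum.distrib deviation_def flip: sum_distrib_left)
qed

text \<open>Clipping is 1-Lipschitz, so the clipped mean serves as the comparison constant.\<close>

lemma deviation_clip:
  fixes x :: "'n::finite \<Rightarrow> real"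
  shows "deviation (\<lambda>i. max (min (x i) hi) lo) \<le> deviation x"
proof -
  have "\<bar>max (min a hi) lo - max (min b hi) lo\<bar> \<le> \<bar>a - b\<bar>" for a b :: real
    by linarith
  then have "(\<Sum>i\<in>UNIV. (max (min (x i) hi) lo - max (min (avg x) hi) lo)\<^sup>2) \<le> deviation x"
    unfolding deviation_def by (intro sum_mono) (simp add: abs_le_square_iff)
  then show ?thesis using deviation_le[of "\<lambda>i. max (min (x i) hi) lo"] by (rule order_trans[rotated])
qed

section \<open>Exponential averages and scalar inequalities\<close>

text \<open>The recursion reads \<open>(1 - \<beta>) * a t \<le> a t - a (t + 1) + (1 - \<beta>) * b
  t\<close>, and the differences telescope.\<close>

lemma sum_smoothed_le:
  fixes a b :: "nat \<Rightarrow> real"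
  assumes step: "\<And>t. 1 \<le> t \<Longrightarrow> a (t + 1) \<le> \<beta> * a t + (1 - \<beta>) * b t"
    and \<beta>: "0 \<le> \<beta>" "\<beta> < 1" and nonneg: "\<And>t. 0 \<le> a t"
  shows "(\<Sum>t=1..T. a t) \<le> a 1 / (1 - \<beta>) + (\<Sum>t=1..T. b t)"
proof -
  have "(\<Sum>t=1..T. a t) * (1 - \<beta>) + a (T + 1) \<le> a 1 + (1 - \<beta>) * (\<Sum>t=1..T. b t)"
  proof (induction T)
    case 0 then show ?case by simp
  next
    case (Suc T)
    then show ?case using step[of "Suc T"] by (simp add: algebra_simps)
  qed
  then have "(\<Sum>t=1..T. a t) * (1 - \<beta>) \<le> a 1 + (1 - \<beta>) * (\<Sum>t=1..T. b t)"
    using nonneg[of "T + 1"] by linarith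
  then have "(\<Sum>t=1..T. a t) \<le> (a 1 + (1 - \<beta>) * (\<Sum>t=1..T. b t)) / (1 - \<beta>)"
    using \<beta> by (simp add: pos_le_divide_eq)
  then show ?thesis using \<beta> by (simp add: add_divide_distrib)
qed

text \<open>
  Divided by \<open>w\<^sup>2\<close>, the right-hand side is a convex function of \<open>w\<^sup>2\<close> and the left-hand side is its tangent
  at \<open>w = b\<close>; so the difference has the factor \<open>(w - b)\<^sup>2\<close>.
\<close>

lemma quartic_tangent:
  fixes w b :: real
  assumes w: "0 \<le> w" and b: "2 \<le> b"
  shows "(b - 2)^3 * w\<^sup>2 * ((b + 2) * w\<^sup>2 - 4 * b\<^sup>2) \<le> b^4 * (max (w - 2) 0)^4"
proof (cases "w \<le> 2")
  case True
  have "(b + 2) * w\<^sup>2 \<le> (b + 2) * 2\<^sup>2"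
    using True w b by (intro mult_left_mono power_mono) auto
  \<comment> \<open>The difference of the two sides is \<open>4 * (b - 2) * (b + 1)\<close>.\<close>
  also have "\<dots> \<le> 4 * b\<^sup>2"
    using mult_nonneg_nonneg[of "b - 2" "b + 1"] b by (simp add: power2_eq_square algebra_simps)
  finally have "(b - 2)^3 * w\<^sup>2 * ((b + 2) * w\<^sup>2 - 4 * b\<^sup>2) \<le> 0"
    using b by (intro mult_nonneg_nonpos) auto
  then show ?thesis using True by simp
next
  case False
  \<comment> \<open>\<open>\<alpha>\<close> is a quarter of the coefficient of w^4 in the difference
    of the two sides.\<close>
  define \<alpha> where "\<alpha> = b^3 - 4*b + 4"
  have \<alpha>: "\<alpha> - 4 * (b - 1)\<^sup>2 = b * (b - 2)\<^sup>2"
    by (simp add: \<alpha>_def power2_eq_square power3_eq_cube algebra_simps)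
  have pos: "0 < \<alpha>"
  proof -
    have "0 < 4 * (b - 1)\<^sup>2" using b by simp
    moreover have "0 \<le> b * (b - 2)\<^sup>2" using b by simp
    ultimately show ?thesis using \<alpha> by linarith
  qed
  \<comment> \<open>Completing the square; the remainder is nonnegative because \<alpha> \<ge> 4 (b
    - 1)^2.\<close>
  have "\<alpha> * (\<alpha> * w\<^sup>2 - 8*b*(b-1)*w + 4*b\<^sup>2)
      = (\<alpha> * w - 4*b*(b-1))\<^sup>2 + 4*b\<^sup>2 * (\<alpha> - 4 * (b - 1)\<^sup>2)"
    by (simp add: power2_eq_square algebra_simps)
  also have "\<dots> \<ge> 0" unfolding \<alpha> using b by simp
  finally have q: "0 \<le> \<alpha> * w\<^sup>2 - 8*b*(b-1)*w + 4*b\<^sup>2"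
    using pos by (simp add: zero_le_mult_iff)
  have "b^4 * (w - 2)^4 - (b - 2)^3 * w\<^sup>2 * ((b + 2) * w\<^sup>2 - 4 * b\<^sup>2)
      = (w - b)\<^sup>2 * (4 * (\<alpha> * w\<^sup>2 - 8*b*(b-1)*w + 4*b\<^sup>2))"
    unfolding \<alpha>_def by Groebner_Basis.algebra
  also have "\<dots> \<ge> 0" using q by simp
  finally show ?thesis using False by simp
qed

text \<open>The target constant dictates \<open>b\<close>: (b + 2)^2 = 36 / (1 - \<rho>)^2. The
  first inequality closes the fourth-moment estimate, and the second keeps the coefficient to be
  divided out positive. At \<rho> = 0 the first is an equality.\<close>

lemma threshold_polynomial:
  fixes \<rho> b K :: real
  assumes \<rho>: "0 \<le> \<rho>" "\<rho> < 1" and b: "b = 6 / (1 - \<rho>) - 2" and K: "K = ((1 + \<rho>) / (1 - \<rho>))\<^sup>2"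
  shows "\<rho>\<^sup>2 * b^4 + (1 - \<rho>\<^sup>2) * K * b\<^sup>2 \<le> (b - 2)^4"
    and "\<rho>\<^sup>2 * b^4 < (b - 2)^3 * (b + 2)"
    and "4 \<le> b"
proof -
  \<comment> \<open>In terms of \<open>j\<close>, and after multiplication by (1 + j)^2, both
    inequalities compare polynomials whose difference has nonnegative coefficients.\<close>
  define j where "j = \<rho> / (1 - \<rho>)"
  have j: "0 \<le> j" using \<rho> by (simp add: j_def)
  have inv: "1 / (1 - \<rho>) = 1 + j" and \<rho>j: "\<rho> = j / (1 + j)"
    using \<rho> by (simp_all add: j_def field_simps)
  have bj: "b = 4 + 6*j" using b inv by (simp add: field_simps)
  have Kj: "K = (1 + 2*j)\<^sup>2"
    using \<rho> by (simp add: K j_def field_simps)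
  show "4 \<le> b" using bj j by simp
  have \<rho>j': "\<rho> * (1 + j) = j" using \<rho>j j by simp
  have sq: "\<rho>\<^sup>2 * (1 + j)\<^sup>2 = j\<^sup>2" using \<rho>j' by (simp flip: power_mult_distrib)
  have "(1 - \<rho>\<^sup>2) * (1 + j)\<^sup>2 = (1 + j)\<^sup>2 - \<rho>\<^sup>2 * (1 + j)\<^sup>2" by (simp add: left_diff_distrib)
  also have "\<dots> = 1 + 2*j" unfolding sq by (simp add: power2_eq_square algebra_simps)
  finally have one: "1 - \<rho>\<^sup>2 = (1 + 2*j) / (1 + j)\<^sup>2" and two: "\<rho>\<^sup>2 = j\<^sup>2 / (1 + j)\<^sup>2"
    using j sq by (simp_all add: eq_divide_eq)
  have "(1 + j)\<^sup>2 * (b - 2)^4 - (j\<^sup>2 * b^4 + (1 + 2*j) * K * b\<^sup>2)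
      = 4 * (20*j + 123*j^2 + 298*j^3 + 336*j^4 + 144*j^5)"
    unfolding bj Kj by Groebner_Basis.algebra
  also have "\<dots> \<ge> 0" using j by simp
  finally have "(j\<^sup>2 * b^4 + (1 + 2*j) * K * b\<^sup>2) / (1 + j)\<^sup>2 \<le> (b - 2)^4"
    using j by (simp add: divide_le_eq mult.commute)
  then show "\<rho>\<^sup>2 * b^4 + (1 - \<rho>\<^sup>2) * K * b\<^sup>2 \<le> (b - 2)^4"
    by (simp only: one) (simp add: two add_divide_distrib[of "j\<^sup>2 * b ^ 4"])
  have "(1 + j)\<^sup>2 * ((b - 2)^3 * (b + 2)) - j\<^sup>2 * b^4
      = 16 * (3 + 36*j + 155*j^2 + 312*j^3 + 297*j^4 + 108*j^5)"
    unfolding bj by Groebner_Basis.algebra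
  also have "\<dots> > 0" using j by (simp add: add_pos_nonneg)
  finally have "j\<^sup>2 * b^4 / (1 + j)\<^sup>2 < (b - 2)^3 * (b + 2)"
    using j by (simp add: divide_less_eq mult.commute)
  then show "\<rho>\<^sup>2 * b^4 < (b - 2)^3 * (b + 2)" unfolding two by simp
qed

subsection \<open>Gradient tracking\<close>

text \<open>\<open>contract\<close> is the form in which the spectral gap is used: on vectors of sum
  zero, subtracting the averaging matrix from \<open>A\<close> changes nothing.\<close>

locale mixing_matrix =
  fixes A :: "'n::finite \<Rightarrow> 'n \<Rightarrow> real" and \<rho> :: real
  assumes nonneg: "0 \<le> A i j"
    and row_sum: "(\<Sum>j\<in>UNIV. A i j) = 1"
    and col_sum: "(\<Sum>i\<in>UNIV. A i j) = 1"
    and rho: "0 \<le> \<rho>" "\<rho> < 1"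
    and contract: "(\<Sum>i\<in>UNIV. x i) = 0 \<Longrightarrow>
      (\<Sum>i\<in>UNIV. (\<Sum>j\<in>UNIV. A i j * x j)\<^sup>2) \<le> \<rho>\<^sup>2 * (\<Sum>i\<in>UNIV. (x i)\<^sup>2)"
begin

definition mix :: "('n \<Rightarrow> real) \<Rightarrow> 'n \<Rightarrow> real" where
  "mix x i = (\<Sum>j\<in>UNIV. A i j * x j)"

lemma sum_mix: "(\<Sum>i\<in>UNIV. mix x i) = (\<Sum>i\<in>UNIV. x i)"
proof -
  have "(\<Sum>i\<in>UNIV. mix x i) = (\<Sum>j\<in>UNIV. \<Sum>i\<in>UNIV. A i j * x j)"
    unfolding mix_def by (rule sum.swap)
  also have "\<dots> = (\<Sum>i\<in>UNIV. x i)" by (simp add: col_sum flip: sum_distrib_right)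
  finally show ?thesis .
qed

lemma avg_mix: "avg (mix x) = avg x"
  by (simp add: avg_def sum_mix)

lemma mix_const: "mix (\<lambda>_. c) i = c"
  by (simp add: mix_def row_sum flip: sum_distrib_right)

lemma mix_add: "mix (\<lambda>i. x i + y i) i = mix x i + mix y i"
  by (simp add: mix_def distrib_left sum.distrib)

lemma mix_diff: "mix (\<lambda>i. x i - y i) i = mix x i - mix y i"
  by (simp add: mix_def right_diff_distrib sum_subtractf)

lemma mix_mono: "(\<And>j. x j \<le> y j) \<Longrightarrow> mix x i \<le> mix y i"
  by (auto simp: mix_def intro!: sum_mono mult_left_mono nonneg)

lemma abs_mix_le: "\<bar>mix x i\<bar> \<le> mix (\<lambda>j. \<bar>x j\<bar>) i"
  unfolding mix_def by (rule order_trans[OF sum_abs]) (simp add: abs_mult nonneg)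

text \<open>Jensen's inequality for the weights of row \<open>i\<close>: the weighted variance of
  \<open>x\<close> around \<open>mix x i\<close> is nonnegative.\<close>

lemma mix_sq_le: "(mix x i)\<^sup>2 \<le> mix (\<lambda>j. (x j)\<^sup>2) i"
proof -
  have "0 \<le> mix (\<lambda>j. (x j - mix x i)\<^sup>2) i"
    unfolding mix_def[of "\<lambda>j. (x j - mix x i)\<^sup>2"] by (intro sum_nonneg mult_nonneg_nonneg nonneg) simp
  also have "\<dots> = mix (\<lambda>j. (x j)\<^sup>2) i - 2 * mix x i * mix x i + mix (\<lambda>_. (mix x i)\<^sup>2) i"
    unfolding mix_def[of "\<lambda>j. (x j - mix x i)\<^sup>2"] mix_def[of "\<lambda>j. (x j)\<^sup>2"]
      mix_def[of "\<lambda>_. (mix x i)\<^sup>2"]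
    by (subst (2) mix_def)
       (simp add: power2_diff algebra_simps sum.distrib sum_subtractf sum_distrib_left)
  finally show ?thesis by (simp add: mix_const power2_eq_square)
qed

text \<open>Constants are fixed by \<open>mix\<close>, so subtracting the mean leaves a vector of
  sum zero, to which \<open>contract\<close> applies.\<close>

lemma deviation_mix: "deviation (mix x) \<le> \<rho>\<^sup>2 * deviation x"
proof -
  have "deviation (mix x) = (\<Sum>i\<in>UNIV. (mix (\<lambda>j. x j - avg x) i)\<^sup>2)"
    by (simp add: deviation_def avg_mix mix_diff mix_const)
  also have "\<dots> \<le> \<rho>\<^sup>2 * deviation x"
    unfolding mix_def deviation_def by (rule contract) simp
  finally show ?thesis .
qed

text \<open>When a sum of squares is split into mean and deviation, \<open>mix\<close> keeps the
  mean part and shrinks the deviation by \<rho>^2.\<close>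

lemma sum_mix_sq_le:
  "(\<Sum>i\<in>UNIV. (mix x i)\<^sup>2) \<le> \<rho>\<^sup>2 * (\<Sum>i\<in>UNIV. (x i)\<^sup>2) + (1 - \<rho>\<^sup>2) * real CARD('n) * (avg x)\<^sup>2"
  using deviation_mix[of x] by (simp add: sum_sq_eq avg_mix algebra_simps)

text \<open>After Jensen, \<open>sum_mix_sq_le\<close> is applied to the squares of
  \<open>x\<close>. Since \<open>K\<close> bounds the mean square, the squared mean becomes a term
  linear in the sum of squares.\<close>

lemma sum_mix_pow4_le:
  assumes K: "(\<Sum>i\<in>UNIV. (x i)\<^sup>2) \<le> K * real CARD('n)"
  shows "(\<Sum>i\<in>UNIV. (mix x i)^4) \<le> \<rho>\<^sup>2 * (\<Sum>i\<in>UNIV. (x i)^4) + (1 - \<rho>\<^sup>2) * K * (\<Sum>i\<in>UNIV. (x i)\<^sup>2)"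
proof -
  have pow4: "a^4 = (a\<^sup>2)\<^sup>2" for a :: real by simp
  let ?y = "\<lambda>i. (x i)\<^sup>2"
  have "(\<Sum>i\<in>UNIV. (mix x i)^4) \<le> (\<Sum>i\<in>UNIV. (mix ?y i)\<^sup>2)"
    unfolding pow4 by (intro sum_mono power_mono mix_sq_le) auto
  also have "\<dots> \<le> \<rho>\<^sup>2 * (\<Sum>i\<in>UNIV. (?y i)\<^sup>2) + (1 - \<rho>\<^sup>2) * (real CARD('n) * (avg ?y)\<^sup>2)"
    using sum_mix_sq_le[of ?y] by (simp add: mult.assoc)
  also have "real CARD('n) * (avg ?y)\<^sup>2 = avg ?y * (\<Sum>i\<in>UNIV. ?y i)"
    by (simp add: sum_eq_avg power2_eq_square)
  also have "(1 - \<rho>\<^sup>2) * (avg ?y * (\<Sum>i\<in>UNIV. ?y i)) \<le> (1 - \<rho>\<^sup>2) * (K * (\<Sum>i\<in>UNIV. ?y i))"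
    using K rho by (intro mult_left_mono mult_right_mono sum_nonneg)
      (auto simp: avg_def divide_le_eq power_le_one)
  finally show ?thesis by (simp add: mult.assoc)
qed

end

section \<open>Scalar gradient tracking with gradients in [-1, 1]\<close>

text \<open>One coordinate of the recursion for \<open>s\<close>, divided by G. The family
  \<open>g\<close> stands for the gradients observed along the path, at whatever points they were
  queried.\<close>

locale tracking = mixing_matrix A \<rho> for A :: "'n::finite \<Rightarrow> 'n \<Rightarrow> real" and \<rho> +
  fixes s g :: "nat \<Rightarrow> 'n \<Rightarrow> real"
  assumes init: "s 1 i = g 1 i"
    and step: "1 \<le> t \<Longrightarrow> s (t + 1) i = mix (s t) i + g (t + 1) i - g t i"
    and bounded: "1 \<le> t \<Longrightarrow> \<bar>g t i\<bar> \<le> 1"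
begin

definition excess :: "nat \<Rightarrow> 'n \<Rightarrow> real" where
  "excess t i = max (\<bar>s t i\<bar> - 1) 0"

lemma excess_nonneg: "0 \<le> excess t i"
  by (simp add: excess_def)

lemma excess_init: "excess 1 i = 0"
  using bounded[of 1 i] by (simp add: excess_def init[unfolded One_nat_def])

text \<open>Before mixing, \<open>\<bar>s t j\<bar>\<close> is at most the excess plus 1, and the
  two gradients add at most 2. So the part of the new excess above 2 is at most the mixed excess;
  truncating it at 0 prepares for fourth powers.\<close>

lemma excess_step:
  assumes "1 \<le> t" shows "max (excess (t + 1) i - 2) 0 \<le> mix (excess t) i"
proof -
  have "\<bar>mix (s t) i\<bar> \<le> mix (\<lambda>j. excess t j + 1) i"
    by (rule order_trans[OF abs_mix_le]) (auto simp: excess_def intro!: mix_mono)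
  also have "\<dots> = mix (excess t) i + 1" by (simp add: mix_add mix_const)
  finally have "\<bar>s (t + 1) i\<bar> \<le> mix (excess t) i + 3"
    using step[OF assms, of i] bounded[OF assms, of i] bounded[of "t + 1" i] by linarith
  moreover have "0 \<le> mix (excess t) i"
    using mix_mono[of "\<lambda>_. 0" "excess t" i] by (simp add: excess_nonneg mix_const)
  ultimately show ?thesis by (simp add: excess_def)
qed

text \<open>The tracking property: unit column sums preserve the total, so the gradient increments
  telescope from \<open>s 1 = g 1\<close>.\<close>

lemma avg_eq: "1 \<le> t \<Longrightarrow> avg (s t) = avg (g t)"
proof (induction t rule: dec_induct)
  case base
  have "s 1 = g 1" using init by auto
  then show ?case by simp
next
  case (step t)
  have "(\<Sum>i\<in>UNIV. s (t + 1) i) = (\<Sum>i\<in>UNIV. mix (s t) i + g (t + 1) i - g t i)"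
    using tracking.step[OF tracking_axioms] step by simp
  then show ?case using step by (simp add: avg_def sum.distrib sum_subtractf sum_mix divide_simps)
qed

lemma abs_avg_le:
  assumes "1 \<le> t" shows "\<bar>avg (s t)\<bar> \<le> 1"
proof -
  have "\<bar>\<Sum>i\<in>UNIV. g t i\<bar> \<le> (\<Sum>i\<in>UNIV. \<bar>g t i\<bar>)" by (rule sum_abs)
  also have "\<dots> \<le> real CARD('n)"
    using sum_bounded_above[of UNIV "\<lambda>i. \<bar>g t i\<bar>" 1] bounded[OF assms] by simp
  finally show ?thesis unfolding avg_eq[OF assms] by (simp add: avg_def divide_le_eq)
qed

text \<open>Both vectors are compared with their common mean, from which they are at distance at
  most \<rho> sqrt(n) and sqrt(n).\<close>

lemma L2_mix_diff_le:
  assumes "1 \<le> t"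
  shows "L2_set (\<lambda>i. mix (g t) i - g t i) UNIV \<le> (1 + \<rho>) * sqrt (real CARD('n))"
proof -
  let ?u = "\<lambda>i. g t i - avg (g t)"
  have dev: "deviation (g t) \<le> real CARD('n)"
  proof -
    have "deviation (g t) \<le> (\<Sum>i\<in>UNIV. (g t i)\<^sup>2)" using deviation_le[of "g t" 0] by simp
    also have "\<dots> \<le> real CARD('n)"
      using sum_bounded_above[of UNIV "\<lambda>i. (g t i)\<^sup>2" 1] bounded[OF assms]
      by (simp add: abs_square_le_1)
    finally show ?thesis .
  qed
  have "L2_set (\<lambda>i. mix (g t) i - g t i) UNIV
      = L2_set (\<lambda>i. (mix (g t) i - avg (g t)) + - ?u i) UNIV" by simp
  also have "\<dots> \<le> L2_set (\<lambda>i. mix (g t) i - avg (g t)) UNIV + L2_set (\<lambda>i. - ?u i) UNIV"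
    by (rule L2_set_triangle_ineq)
  also have "\<dots> = sqrt (deviation (mix (g t))) + sqrt (deviation (g t))"
    by (simp add: L2_set_def deviation_def avg_mix power2_commute)
  also have "\<dots> \<le> sqrt (\<rho>\<^sup>2 * real CARD('n)) + sqrt (real CARD('n))"
    using dev by (intro add_mono real_sqrt_le_mono order_trans[OF deviation_mix] mult_left_mono) auto
  also have "\<dots> = (1 + \<rho>) * sqrt (real CARD('n))"
    using rho by (simp add: real_sqrt_mult algebra_simps)
  finally show ?thesis .
qed

text \<open>The error q = s - g starts at zero, keeps sum zero, and its next value is A q + (A g -
  g). The bound is the fixed point of e = \<rho> e + (1 + \<rho>) sqrt(n).\<close>

lemma tracking_error:
  assumes "1 \<le> t"
  shows "L2_set (\<lambda>i. s t i - g t i) UNIV \<le> (1 + \<rho>) / (1 - \<rho>) * sqrt (real CARD('n))"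
  using assms
proof (induction t rule: dec_induct)
  case base
  show ?case using rho init by (simp add: L2_set_def)
next
  case (step t)
  let ?q = "\<lambda>i. s t i - g t i"
  have eq: "s (t + 1) i - g (t + 1) i = mix ?q i + (mix (g t) i - g t i)" for i
    using tracking.step[OF tracking_axioms, of t i] step by (simp add: mix_diff)
  have "(\<Sum>i\<in>UNIV. ?q i) = 0"
    using avg_eq[of t] step by (simp add: sum_subtractf sum_eq_avg)
  then have "L2_set (mix ?q) UNIV \<le> sqrt (\<rho>\<^sup>2 * (\<Sum>i\<in>UNIV. (?q i)\<^sup>2))"
    unfolding L2_set_def mix_def by (intro real_sqrt_le_mono contract)
  also have "\<dots> = \<rho> * L2_set ?q UNIV"
    using rho by (simp add: L2_set_def real_sqrt_mult)
  also have "\<dots> \<le> \<rho> * ((1 + \<rho>) / (1 - \<rho>) * sqrt (real CARD('n)))"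
    using step rho by (intro mult_left_mono) auto
  finally have "L2_set (mix ?q) UNIV \<le> \<rho> * ((1 + \<rho>) / (1 - \<rho>) * sqrt (real CARD('n)))" .
  moreover have "L2_set (\<lambda>i. s (t + 1) i - g (t + 1) i) UNIV
      \<le> L2_set (mix ?q) UNIV + L2_set (\<lambda>i. mix (g t) i - g t i) UNIV"
    unfolding eq by (rule L2_set_triangle_ineq)
  ultimately have "L2_set (\<lambda>i. s (t + 1) i - g (t + 1) i) UNIV
      \<le> \<rho> * ((1 + \<rho>) / (1 - \<rho>) * sqrt (real CARD('n))) + (1 + \<rho>) * sqrt (real CARD('n))"
    using L2_mix_diff_le[of t] step by simp
  also have "\<dots> = (1 + \<rho>) / (1 - \<rho>) * sqrt (real CARD('n))"
  proof -
    have "\<rho> * (1 + \<rho>) / (1 - \<rho>) + (1 + \<rho>) = (1 + \<rho>) / (1 - \<rho>)"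
      using rho by (simp add: field_simps)
    then have "(\<rho> * (1 + \<rho>) / (1 - \<rho>) + (1 + \<rho>)) * sqrt (real CARD('n))
        = (1 + \<rho>) / (1 - \<rho>) * sqrt (real CARD('n))" by (rule arg_cong)
    then show ?thesis by (simp add: algebra_simps)
  qed
  finally show ?case by simp
qed

text \<open>
  Bounding the excess by \<open>\<bar>s - g\<bar>\<close> rather than by \<open>\<bar>s - avg s\<bar>\<close> matters: the latter gives the constant
  \<open>(2 / (1 - \<rho>))\<^sup>2\<close>, which is too large when \<open>\<rho>\<close> is close to \<open>0\<close>.
\<close>

lemma excess_sum_sq_le:
  assumes "1 \<le> t"
  shows "(\<Sum>i\<in>UNIV. (excess t i)\<^sup>2) \<le> ((1 + \<rho>) / (1 - \<rho>))\<^sup>2 * real CARD('n)"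
proof -
  have "excess t i \<le> \<bar>s t i - g t i\<bar>" for i
    using bounded[OF assms, of i] by (simp add: excess_def)
  then have "(\<Sum>i\<in>UNIV. (excess t i)\<^sup>2) \<le> (\<Sum>i\<in>UNIV. (s t i - g t i)\<^sup>2)"
    by (intro sum_mono) (simp add: abs_le_square_iff[symmetric] excess_nonneg)
  also have "\<dots> = (L2_set (\<lambda>i. s t i - g t i) UNIV)\<^sup>2"
    by (simp add: L2_set_def sum_nonneg)
  also have "\<dots> \<le> ((1 + \<rho>) / (1 - \<rho>) * sqrt (real CARD('n)))\<^sup>2"
    by (intro power_mono tracking_error assms L2_set_nonneg)
  also have "\<dots> = ((1 + \<rho>) / (1 - \<rho>))\<^sup>2 * real CARD('n)"
    unfolding power_mult_distrib by simp
  finally show ?thesis .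
qed

section \<open>Fourth moments of the excess\<close>

text \<open>\<open>excess_step\<close> bounds the time sum of \<open>Q\<close> from above and
  \<open>quartic_tangent\<close> bounds it from below, both linearly in the sums of \<open>X\<close>
  and \<open>Y\<close>. Solving for the sum of \<open>X\<close> gives the bound.\<close>

lemma sum_excess_pow4_le:
  defines "b \<equiv> 6 / (1 - \<rho>) - 2"
  shows "(\<Sum>t=1..T. \<Sum>i\<in>UNIV. (excess t i)^4) \<le> b\<^sup>2 * (\<Sum>t=1..T. \<Sum>i\<in>UNIV. (excess t i)\<^sup>2)"
proof -
  define K where "K = ((1 + \<rho>) / (1 - \<rho>))\<^sup>2"
  define X where "X = (\<lambda>t. \<Sum>i\<in>UNIV. (excess t i)^4)"
  define Y where "Y = (\<lambda>t. \<Sum>i\<in>UNIV. (excess t i)\<^sup>2)"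
  define Q where "Q = (\<lambda>t. \<Sum>i\<in>UNIV. (max (excess t i - 2) 0)^4)"
  have b_def': "b = 6 / (1 - \<rho>) - 2" by (simp add: b_def)
  note poly = threshold_polynomial[OF rho b_def' K_def]
  have XY: "0 \<le> X t" "0 \<le> Y t" for t by (simp_all add: X_def Y_def sum_nonneg)
  have r2: "0 \<le> 1 - \<rho>\<^sup>2" using rho by (simp add: power_le_one)
  have K0: "0 \<le> K" by (simp add: K_def)
  have Q1: "Q (Suc 0) = 0" using excess_init by (simp add: Q_def)
  have Qstep: "Q (Suc t) \<le> \<rho>\<^sup>2 * X t + (1 - \<rho>\<^sup>2) * K * Y t" if "1 \<le> t" for t
  proof -
    have "Q (t + 1) \<le> (\<Sum>i\<in>UNIV. (mix (excess t) i)^4)"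
      unfolding Q_def by (intro sum_mono power_mono excess_step that) auto
    also have "\<dots> \<le> \<rho>\<^sup>2 * X t + (1 - \<rho>\<^sup>2) * K * Y t"
      unfolding X_def Y_def K_def by (intro sum_mix_pow4_le excess_sum_sq_le that)
    finally show ?thesis by simp
  qed
  have sumQ: "(\<Sum>t=1..T. Q t) \<le> \<rho>\<^sup>2 * (\<Sum>t=1..T. X t) + (1 - \<rho>\<^sup>2) * K * (\<Sum>t=1..T. Y t)"
  proof (cases T)
    case 0 then show ?thesis by simp
  next
    case (Suc T')
    \<comment> \<open>\<open>Q\<close> vanishes at time 1, so its sum up to \<open>T\<close> is a
      shifted sum up to \<open>T'\<close>; the term for time \<open>T\<close> added on the right is
      nonnegative.\<close>
    have "(\<Sum>t=1..T. Q t) = (\<Sum>t=1..T'. Q (Suc t))"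
      by (simp only: Suc One_nat_def sum.atLeast1_atMost_eq sum.lessThan_Suc_shift Q1 add_0)
    also have "\<dots> \<le> (\<Sum>t=1..T'. \<rho>\<^sup>2 * X t + (1 - \<rho>\<^sup>2) * K * Y t)"
      by (intro sum_mono Qstep) auto
    also have "\<dots> \<le> (\<Sum>t=1..T. \<rho>\<^sup>2 * X t + (1 - \<rho>\<^sup>2) * K * Y t)"
      unfolding Suc using XY r2 K0 by simp
    finally show ?thesis by (simp add: sum.distrib sum_distrib_left)
  qed
  define x where "x = (\<Sum>t=1..T. X t)"
  define y where "y = (\<Sum>t=1..T. Y t)"
  have y0: "0 \<le> y" using XY by (simp add: y_def sum_nonneg)
  have pt: "(b - 2)^3 * (b + 2) * X t - 4 * b\<^sup>2 * (b - 2)^3 * Y t \<le> b^4 * Q t" for t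
  proof -
    have "(b - 2)^3 * (b + 2) * X t - 4 * b\<^sup>2 * (b - 2)^3 * Y t
       = (\<Sum>i\<in>UNIV. (b - 2)^3 * (excess t i)\<^sup>2 * ((b + 2) * (excess t i)\<^sup>2 - 4 * b\<^sup>2))"
      unfolding X_def Y_def sum_distrib_left sum_subtractf[symmetric]
      by (intro sum.cong refl) Groebner_Basis.algebra
    also have "\<dots> \<le> b^4 * Q t"
      unfolding Q_def sum_distrib_left using poly(3)
      by (intro sum_mono quartic_tangent excess_nonneg) auto
    finally show ?thesis .
  qed
  have "(b - 2)^3 * (b + 2) * x - 4 * b\<^sup>2 * (b - 2)^3 * y
      = (\<Sum>t=1..T. (b - 2)^3 * (b + 2) * X t - 4 * b\<^sup>2 * (b - 2)^3 * Y t)"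
    by (simp add: x_def y_def sum_subtractf sum_distrib_left)
  also have "\<dots> \<le> (\<Sum>t=1..T. b^4 * Q t)" by (rule sum_mono) (rule pt)
  also have "\<dots> \<le> b^4 * (\<rho>\<^sup>2 * x + (1 - \<rho>\<^sup>2) * K * y)"
    unfolding sum_distrib_left[symmetric] x_def y_def using sumQ by (intro mult_left_mono) auto
  finally have "((b - 2)^3 * (b + 2) - \<rho>\<^sup>2 * b^4) * x
      \<le> (4 * b\<^sup>2 * (b - 2)^3 + b^4 * ((1 - \<rho>\<^sup>2) * K)) * y"
    by (simp add: algebra_simps)
  also have "\<dots> \<le> (((b - 2)^3 * (b + 2) - \<rho>\<^sup>2 * b^4) * b\<^sup>2) * y"
  proof (rule mult_right_mono[OF _ y0])
    \<comment> \<open>As (b + 2) - 4 = b - 2, the slack is b^2 times that of the first inequality in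
      \<open>threshold_polynomial\<close>.\<close>
    have "((b - 2)^3 * (b + 2) - \<rho>\<^sup>2 * b^4) * b\<^sup>2 - (4 * b\<^sup>2 * (b - 2)^3 + b^4 * ((1 - \<rho>\<^sup>2) * K))
       = b\<^sup>2 * ((b - 2)^4 - (\<rho>\<^sup>2 * b^4 + (1 - \<rho>\<^sup>2) * K * b\<^sup>2))" by Groebner_Basis.algebra
    also have "\<dots> \<ge> 0" using poly(1) by (intro mult_nonneg_nonneg) auto
    finally show "4 * b\<^sup>2 * (b - 2)^3 + b^4 * ((1 - \<rho>\<^sup>2) * K)
      \<le> ((b - 2)^3 * (b + 2) - \<rho>\<^sup>2 * b^4) * b\<^sup>2" by simp
  qed
  finally have "((b - 2)^3 * (b + 2) - \<rho>\<^sup>2 * b^4) * x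
      \<le> ((b - 2)^3 * (b + 2) - \<rho>\<^sup>2 * b^4) * (b\<^sup>2 * y)" by (simp add: mult.assoc)
  \<comment> \<open>The common factor is positive by the second inequality in
    \<open>threshold_polynomial\<close>, so it cancels.\<close>
  then have "x \<le> b\<^sup>2 * y" using poly(2) by simp
  then show ?thesis by (simp add: x_def y_def X_def Y_def)
qed

lemma abs_sq_diff_avg_le:
  assumes "1 \<le> t"
  shows "\<bar>(s t i)\<^sup>2 - (avg (s t))\<^sup>2\<bar> \<le> (excess t i)\<^sup>2 + 2 * \<bar>s t i - avg (s t)\<bar>"
    and "excess t i \<le> \<bar>s t i - avg (s t)\<bar>"
proof -
  define p c where "p = \<bar>s t i\<bar>" and "c = \<bar>avg (s t)\<bar>"
  have c: "0 \<le> c" "c \<le> 1" and p: "0 \<le> p" using abs_avg_le[OF assms] by (auto simp: c_def p_def)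
  have e: "\<bar>p - c\<bar> \<le> \<bar>s t i - avg (s t)\<bar>" by (simp add: p_def c_def)
  have "\<bar>p\<^sup>2 - c\<^sup>2\<bar> \<le> (max (p - 1) 0)\<^sup>2 + 2 * \<bar>p - c\<bar>"
  proof (cases "p \<le> 1")
    case True
    have "\<bar>p\<^sup>2 - c\<^sup>2\<bar> = \<bar>p + c\<bar> * \<bar>p - c\<bar>"
      by (simp add: power2_eq_square square_diff_square_factored flip: abs_mult)
    also have "\<dots> \<le> 2 * \<bar>p - c\<bar>" using True c p by (intro mult_right_mono) auto
    finally show ?thesis using True by simp
  next
    case False
    \<comment> \<open>Here p^2 - c^2 = (p - 1)^2 + 2 (p - c) - (1 - c)^2.\<close>
    have "c\<^sup>2 \<le> p\<^sup>2" using False c by (intro power_mono) auto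
    moreover have "0 \<le> (1 - c)\<^sup>2" by simp
    ultimately show ?thesis using False c by (simp add: power2_eq_square algebra_simps)
  qed
  then show "\<bar>(s t i)\<^sup>2 - (avg (s t))\<^sup>2\<bar> \<le> (excess t i)\<^sup>2 + 2 * \<bar>s t i - avg (s t)\<bar>"
    using e by (simp add: p_def c_def excess_def)
  show "excess t i \<le> \<bar>s t i - avg (s t)\<bar>"
    using e c by (simp add: excess_def p_def)
qed

text \<open>The deviation of the squares splits into fourth powers of the excess and the deviation
  of \<open>s\<close>; \<open>sum_excess_pow4_le\<close> trades the former for the latter.\<close>

lemma sum_deviation_sq_le:
  "(\<Sum>t=1..T. deviation (\<lambda>i. (s t i)\<^sup>2)) \<le> 36 / (1 - \<rho>)\<^sup>2 * (\<Sum>t=1..T. deviation (s t))"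
proof -
  define b where "b = 6 / (1 - \<rho>) - 2"
  have b: "4 \<le> b" using threshold_polynomial(3)[OF rho b_def refl] .
  define y where "y = (\<Sum>t=1..T. deviation (s t))"
  define x2 where "x2 = (\<Sum>t=1..T. \<Sum>i\<in>UNIV. (excess t i)\<^sup>2)"
  define x4 where "x4 = (\<Sum>t=1..T. \<Sum>i\<in>UNIV. (excess t i)^4)"
  have x2y: "x2 \<le> y" unfolding x2_def y_def deviation_def
    using abs_sq_diff_avg_le(2)
    by (intro sum_mono) (simp add: abs_le_square_iff[symmetric] excess_nonneg)
  have x42: "x4 \<le> b\<^sup>2 * x2" unfolding x4_def x2_def b_def by (rule sum_excess_pow4_le)
  have dev: "deviation (\<lambda>i. (s t i)\<^sup>2)
      \<le> (1 + 2 / b) * (\<Sum>i\<in>UNIV. (excess t i)^4) + (4 + 2 * b) * deviation (s t)" if "1 \<le> t" for t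
  proof -
    \<comment> \<open>The cross term is split with weights 2/b and 2b, so that the final coefficient
      (1 + 2/b) b^2 + (4 + 2b) is the square (b + 2)^2.\<close>
    have amgm: "(w\<^sup>2 + 2 * e)\<^sup>2 \<le> (1 + 2 / b) * w^4 + (4 + 2 * b) * e\<^sup>2" for w e :: real
    proof -
      have "(1 + 2 / b) * w^4 + (4 + 2 * b) * e\<^sup>2 - (w\<^sup>2 + 2 * e)\<^sup>2 = 2 / b * (w\<^sup>2 - b * e)\<^sup>2"
        using b by (simp add: field_simps power2_eq_square power4_eq_xxxx)
      also have "\<dots> \<ge> 0" using b by simp
      finally show ?thesis by simp
    qed
    have "deviation (\<lambda>i. (s t i)\<^sup>2) \<le> (\<Sum>i\<in>UNIV. ((s t i)\<^sup>2 - (avg (s t))\<^sup>2)\<^sup>2)"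
      by (rule deviation_le)
    also have "\<dots> \<le> (\<Sum>i\<in>UNIV. ((excess t i)\<^sup>2 + 2 * \<bar>s t i - avg (s t)\<bar>)\<^sup>2)"
    proof (rule sum_mono)
      fix i
      show "((s t i)\<^sup>2 - (avg (s t))\<^sup>2)\<^sup>2 \<le> ((excess t i)\<^sup>2 + 2 * \<bar>s t i - avg (s t)\<bar>)\<^sup>2"
        using abs_sq_diff_avg_le(1)[OF that, of i] by (rule abs_le_square_iff[THEN iffD1, OF order_trans]) simp
    qed
    also have "\<dots> \<le> (\<Sum>i\<in>UNIV. (1 + 2 / b) * (excess t i)^4 + (4 + 2 * b) * \<bar>s t i - avg (s t)\<bar>\<^sup>2)"
      by (rule sum_mono) (rule amgm)
    finally show ?thesis by (simp add: sum.distrib sum_distrib_left deviation_def)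
  qed
  have "(\<Sum>t=1..T. deviation (\<lambda>i. (s t i)\<^sup>2))
      \<le> (\<Sum>t=1..T. (1 + 2 / b) * (\<Sum>i\<in>UNIV. (excess t i)^4) + (4 + 2 * b) * deviation (s t))"
    by (intro sum_mono dev) simp
  also have "\<dots> = (1 + 2 / b) * x4 + (4 + 2 * b) * y"
    by (simp add: sum.distrib sum_distrib_left x4_def y_def)
  also have "\<dots> \<le> (1 + 2 / b) * (b\<^sup>2 * y) + (4 + 2 * b) * y"
    using x42 x2y b by (intro add_mono mult_left_mono order_trans[OF x42]) auto
  also have "\<dots> = (b + 2)\<^sup>2 * y" using b by (simp add: field_simps power2_eq_square)
  also have "\<dots> = 36 / (1 - \<rho>)\<^sup>2 * y" by (simp add: b_def power_divide)
  finally show ?thesis by (simp add: y_def)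
qed

end

subsection \<open>Spectral radius of a symmetric matrix\<close>

text \<open>The entries of \<open>z\<close>, listed in the enumeration behind
  \<open>complex_mat_of\<close>, form an eigenvector of the complex matrix, so \<open>c\<close> lies
  in its spectrum.\<close>

lemma eigenvalue_le_matrix_spectral_radius:
  fixes B :: "real ^ 'n::finite ^ 'n"
  assumes z: "z \<noteq> 0" and eig: "B *v z = c *\<^sub>R z"
  shows "\<bar>c\<bar> \<le> matrix_spectral_radius B"
proof -
  let ?N = "CARD('n)"
  let ?e = "from_nat_into (UNIV :: 'n set)"
  let ?C = "complex_mat_of B"
  let ?v = "Matrix.vec ?N (\<lambda>k. complex_of_real (z $ ?e k))"
  have bij: "bij_betw ?e {..<?N} UNIV"
    using bij_betw_from_nat_into_finite[of "UNIV :: 'n set"] by simp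
  have C: "?C \<in> carrier_mat ?N ?N" by (simp add: complex_mat_of_def)
  have nz: "?v \<noteq> 0\<^sub>v ?N"
  proof
    assume *: "?v = 0\<^sub>v ?N"
    have "z $ i = 0" for i
    proof -
      obtain k where k: "k < ?N" "?e k = i" using bij by (metis bij_betw_iff_bijections UNIV_I lessThan_iff)
      have "vec_index ?v k = vec_index (0\<^sub>v ?N) k" using * by simp
      then show ?thesis using k by simp
    qed
    then show False using z by (simp add: Finite_Cartesian_Product.vec_eq_iff)
  qed
  have "?C *\<^sub>v ?v = complex_of_real c \<cdot>\<^sub>v ?v"
  proof (rule eq_vecI)
    fix k assume "k < dim_vec (complex_of_real c \<cdot>\<^sub>v ?v)"
    then have k: "k < ?N" by simp
    have "vec_index (?C *\<^sub>v ?v) k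
        = (\<Sum>l\<in>{..<?N}. complex_of_real (B $ ?e k $ ?e l) * complex_of_real (z $ ?e l))"
      using k by (auto simp: complex_mat_of_def scalar_prod_def lessThan_atLeast0 intro!: sum.cong)
    also have "\<dots> = (\<Sum>j\<in>UNIV. complex_of_real (B $ ?e k $ j) * complex_of_real (z $ j))"
      using sum.reindex_bij_betw[OF bij,
          of "\<lambda>j. complex_of_real (B $ ?e k $ j) * complex_of_real (z $ j)"] .
    also have "\<dots> = complex_of_real ((B *v z) $ ?e k)"
      by (simp add: matrix_vector_mult_def)
    also have "\<dots> = vec_index (complex_of_real c \<cdot>\<^sub>v ?v) k"
      unfolding eig using k by simp
    finally show "vec_index (?C *\<^sub>v ?v) k = vec_index (complex_of_real c \<cdot>\<^sub>v ?v) k" .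
  qed (simp add: complex_mat_of_def)
  then have "eigenvector ?C ?v (complex_of_real c)"
    using C nz by (simp add: eigenvector_def)
  then have "complex_of_real c \<in> spectrum ?C"
    by (auto simp: spectrum_def eigenvalue_def)
  then have "norm (complex_of_real c) \<in> norm ` spectrum ?C" by (rule imageI)
  from spectral_radius_mem_max(2)[OF C _ this] show ?thesis
    by (simp add: matrix_spectral_radius_def)
qed

text \<open>
  A maximiser \<open>x\<close> of \<open>norm (B *v x)\<close> on the unit sphere, with maximum \<open>l\<close>, satisfies \<open>B\<^sup>2 x = l\<^sup>2 x\<close>;
  so \<open>B x + l x\<close> is an eigenvector for \<open>l\<close>, unless it vanishes and \<open>x\<close> is one for \<open>- l\<close>.
\<close>

lemma symmetric_matrix_norm_le:
  fixes B :: "real ^ 'n::finite ^ 'n"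
  assumes sym: "transpose B = B"
  shows "norm (B *v y) \<le> matrix_spectral_radius B * norm y"
proof -
  have lin: "linear ((*v) B)" by (rule matrix_vector_mul_linear)
  have "axis undefined 1 \<in> sphere (0 :: real ^ 'n) 1" by (simp add: norm_axis_1)
  then have "sphere (0 :: real ^ 'n) 1 \<noteq> {}" by blast
  then have "\<exists>x\<in>sphere 0 1. \<forall>y\<in>sphere 0 1. norm (B *v y) \<le> norm (B *v x)"
    by (intro continuous_attains_sup continuous_on_norm matrix_vector_mult_linear_continuous_on) auto
  then obtain x where x: "norm x = 1" and "\<forall>y\<in>sphere 0 1. norm (B *v y) \<le> norm (B *v x)"
    by auto
  then have max: "norm (B *v y) \<le> norm (B *v x)" if "norm y = 1" for y
    using that by simp
  define l where "l = norm (B *v x)"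
  have bound: "norm (B *v y) \<le> l * norm y" for y
  proof (cases "y = 0")
    case False
    have "norm (B *v ((1 / norm y) *\<^sub>R y)) \<le> l"
      unfolding l_def using False by (intro max) simp
    then show ?thesis using False by (simp add: linear_cmul[OF lin] divide_le_eq)
  qed simp
  have l: "0 \<le> l" by (simp add: l_def)
  \<comment> \<open>By symmetry the inner product is l^2, and the first term is at most l^4, so the
    total is at most l^4 - 2 l^4 + l^4 = 0.\<close>
  have "(norm (B *v (B *v x) - l\<^sup>2 *\<^sub>R x))\<^sup>2
      = (norm (B *v (B *v x)))\<^sup>2 - 2 * l\<^sup>2 * ((B *v (B *v x)) \<bullet> x) + l\<^sup>2 * l\<^sup>2 * (norm x)\<^sup>2"
    unfolding power2_norm_eq_inner
    by (simp add: inner_diff_left inner_diff_right inner_commute algebra_simps)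
  also have "(B *v (B *v x)) \<bullet> x = l\<^sup>2"
    using dot_lmul_matrix[of "B *v x" B x] transpose_matrix_vector[of B "B *v x"]
    by (simp add: l_def power2_norm_eq_inner sym)
  also have "(norm (B *v (B *v x)))\<^sup>2 \<le> (l * l)\<^sup>2"
    using bound[of "B *v x"] by (intro power_mono) (auto simp: l_def)
  finally have "(norm (B *v (B *v x) - l\<^sup>2 *\<^sub>R x))\<^sup>2 \<le> 0"
    by (simp add: x power2_eq_square)
  then have "B *v (B *v x) = l\<^sup>2 *\<^sub>R x" by simp
  moreover define z where "z = B *v x + l *\<^sub>R x"
  ultimately have Bz: "B *v z = l *\<^sub>R z"
    by (simp add: linear_add[OF lin] linear_cmul[OF lin] algebra_simps power2_eq_square)
  have "l \<le> matrix_spectral_radius B"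
  proof (cases "z = 0")
    case True
    then have "B *v x = (- l) *\<^sub>R x" by (simp add: z_def eq_neg_iff_add_eq_0)
    moreover have "x \<noteq> 0" using x by auto
    ultimately show ?thesis using eigenvalue_le_matrix_spectral_radius[of x B "- l"] l by simp
  next
    case False
    then show ?thesis using eigenvalue_le_matrix_spectral_radius[OF _ Bz] l by simp
  qed
  then show ?thesis using bound[of y] mult_right_mono[of l "matrix_spectral_radius B" "norm y"]
    by simp
qed

subsection \<open>Random gradients\<close>

lemma GDERIV_imp_continuous: "GDERIV f y :> D \<Longrightarrow> isCont f y"
  unfolding gderiv_def by (rule has_derivative_continuous)

lemma GDERIV_line:
  assumes "GDERIV f (p + t *\<^sub>R h) :> D"
  shows "((\<lambda>t. f (p + t *\<^sub>R h)) has_real_derivative (h \<bullet> D)) (at t)"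
proof -
  have "((\<lambda>t. p + t *\<^sub>R h) has_derivative (\<lambda>u. u *\<^sub>R h)) (at t)"
    by (auto intro!: derivative_eq_intros)
  from has_derivative_compose[OF this assms[unfolded gderiv_def]]
  show ?thesis by (simp add: has_field_derivative_def mult_commute_abs)
qed

text \<open>Steps 1/(n + 1) make the directional derivative the limit of a sequence, so that
  measurability and bounds pass to it.\<close>

lemma GDERIV_difference_quotient:
  assumes "GDERIV f y :> D"
  shows "(\<lambda>n. (f (y + inverse (real (Suc n)) *\<^sub>R h) - f y) / inverse (real (Suc n)))
    \<longlonglongrightarrow> h \<bullet> D"
proof -
  have "((\<lambda>t. f (y + t *\<^sub>R h)) has_real_derivative (h \<bullet> D)) (at 0)"
    using assms by (intro GDERIV_line) simp
  then have "(\<lambda>t. (f (y + t *\<^sub>R h) - f y) / t) \<midarrow>0\<rightarrow> h \<bullet> D"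
    by (simp add: DERIV_def)
  moreover have "filterlim (\<lambda>n. inverse (real (Suc n))) (at 0) sequentially"
    by (simp add: filterlim_at LIMSEQ_inverse_real_of_nat del: of_nat_Suc)
  ultimately show ?thesis by (rule filterlim_compose)
qed

section \<open>Measurability of gradients at random points\<close>

text \<open>For a simple function in place of \<open>X\<close>, only countably many sections of
  \<open>F\<close> occur and each is measurable. Continuity in \<open>y\<close> carries this over to
  the limit \<open>X\<close>.\<close>

lemma measurable_caratheodory:
  fixes F :: "'y::{metric_space, second_countable_topology} \<Rightarrow> 'b \<Rightarrow> real"
  assumes F: "\<And>y. F y \<in> borel_measurable D"
    and cont: "\<And>y z. z \<in> space D \<Longrightarrow> isCont (\<lambda>y. F y z) y"
    and X: "X \<in> borel_measurable N" and Z: "Z \<in> measurable N D"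
  shows "(\<lambda>\<omega>. F (X \<omega>) (Z \<omega>)) \<in> borel_measurable N"
proof -
  obtain Y where Y: "\<And>n. simple_function N (Y n)"
    and lim: "\<And>\<omega>. \<omega> \<in> space N \<Longrightarrow> (\<lambda>n. Y n \<omega>) \<longlonglongrightarrow> X \<omega>"
    using borel_measurable_implies_sequence_metric[OF X, of undefined] by blast
  show ?thesis
  proof (rule borel_measurable_LIMSEQ_metric)
    fix n
    show "(\<lambda>\<omega>. F (Y n \<omega>) (Z \<omega>)) \<in> borel_measurable N"
    proof (rule measurable_compose_countable'[where f = "\<lambda>y \<omega>. F y (Z \<omega>)" and g = "Y n" and I = "Y n ` space N"])
      show "(\<lambda>\<omega>. F y (Z \<omega>)) \<in> borel_measurable N" for y
        using measurable_compose[OF Z F] .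
      show "Y n \<in> measurable N (count_space (Y n ` space N))"
        using Y[of n] by (auto simp: simple_function_def measurable_count_space_eq2)
      show "countable (Y n ` space N)"
        using Y[of n] by (auto simp: simple_function_def countable_finite)
    qed
  next
    fix \<omega> assume \<omega>: "\<omega> \<in> space N"
    then have "Z \<omega> \<in> space D" using Z by (rule measurable_space[rotated])
    then show "(\<lambda>n. F (Y n \<omega>) (Z \<omega>)) \<longlonglongrightarrow> F (X \<omega>) (Z \<omega>)"
      by (intro isCont_tendsto_compose[OF cont lim] \<omega>)
  qed
qed

lemma borel_measurable_vecI:
  fixes X :: "'a \<Rightarrow> real ^ 'd::finite"
  assumes "\<And>k. (\<lambda>\<omega>. X \<omega> $ k) \<in> borel_measurable N"
  shows "X \<in> borel_measurable N"
  unfolding borel_measurable_euclidean_space[where f = X]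
proof
  fix b :: "real ^ 'd" assume "b \<in> Basis"
  then obtain k where "b = axis k 1" by (auto simp: Basis_vec_def)
  then show "(\<lambda>\<omega>. X \<omega> \<bullet> b) \<in> borel_measurable N"
    using assms[of k] by (simp add: inner_axis)
qed

lemma borel_measurable_vec_nth:
  fixes X :: "'a \<Rightarrow> real ^ 'd::finite"
  assumes "X \<in> borel_measurable N"
  shows "(\<lambda>\<omega>. X \<omega> $ k) \<in> borel_measurable N"
proof -
  have "(\<lambda>\<omega>. X \<omega> \<bullet> axis k 1) \<in> borel_measurable N" using assms by simp
  then show ?thesis by (simp add: inner_axis)
qed

text \<open>Each component is a limit of difference quotients of \<open>F\<close>, and these are
  measurable by \<open>measurable_caratheodory\<close>.\<close>

lemma measurable_gradient:
  fixes F :: "real ^ 'd::finite \<Rightarrow> 'b \<Rightarrow> real"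
  assumes F: "\<And>y. F y \<in> borel_measurable D"
    and grad: "\<And>y z. z \<in> space D \<Longrightarrow> GDERIV (\<lambda>y. F y z) y :> dF y z"
    and X: "X \<in> borel_measurable N" and Z: "Z \<in> measurable N D"
  shows "(\<lambda>\<omega>. dF (X \<omega>) (Z \<omega>)) \<in> borel_measurable N"
proof (rule borel_measurable_vecI)
  fix k
  let ?r = "\<lambda>n. inverse (real (Suc n))"
  have m: "(\<lambda>\<omega>. F (Y \<omega>) (Z \<omega>)) \<in> borel_measurable N" if "Y \<in> borel_measurable N" for Y
    using F GDERIV_imp_continuous[OF grad] that Z by (rule measurable_caratheodory)
  show "(\<lambda>\<omega>. dF (X \<omega>) (Z \<omega>) $ k) \<in> borel_measurable N"
  proof (rule borel_measurable_LIMSEQ_metric)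
    fix n
    show "(\<lambda>\<omega>. (F (X \<omega> + ?r n *\<^sub>R axis k 1) (Z \<omega>) - F (X \<omega>) (Z \<omega>)) / ?r n) \<in> borel_measurable N"
      using X by (intro borel_measurable_divide borel_measurable_diff m) auto
  next
    fix \<omega> assume "\<omega> \<in> space N"
    then have "Z \<omega> \<in> space D" using Z by (rule measurable_space[rotated])
    from GDERIV_difference_quotient[OF grad[OF this], of "X \<omega>" "axis k 1"]
    show "(\<lambda>n. (F (X \<omega> + ?r n *\<^sub>R axis k 1) (Z \<omega>) - F (X \<omega>) (Z \<omega>)) / ?r n)
        \<longlonglongrightarrow> dF (X \<omega>) (Z \<omega>) $ k"
      by (simp add: inner_axis')
  qed
qed

section \<open>A gradient bound at all points simultaneously\<close>

text \<open>The null set in \<open>bound\<close> depends on \<open>y\<close>, and the points are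
  uncountably many. The Lipschitz property with constant \<open>G\<close> needs checking only for
  countably many pairs of points, and it still bounds every gradient.\<close>

lemma AE_gradient_norm_le:
  fixes F :: "real ^ 'd::finite \<Rightarrow> 'b \<Rightarrow> real"
  assumes "prob_space D"
    and F: "\<And>y. F y \<in> borel_measurable D"
    and grad: "\<And>y z. z \<in> space D \<Longrightarrow> GDERIV (\<lambda>y. F y z) y :> dF y z"
    and G: "0 \<le> G" and bound: "\<And>y. AE z in D. norm (dF y z) \<le> G"
  shows "AE z in D. \<forall>y. norm (dF y z) \<le> G"
proof -
  interpret D: prob_space D by fact
  interpret P: pair_sigma_finite "lborel :: real measure" D ..
  have seg: "AE z in D. \<bar>F q z - F p z\<bar> \<le> G * norm (q - p)" for p q
  proof -
    let ?l = "\<lambda>t. p + t *\<^sub>R (q - p)"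
    have meas: "(\<lambda>x. dF (?l (fst x)) (snd x)) \<in> borel_measurable (lborel \<Otimes>\<^sub>M D)"
      by (rule measurable_gradient[OF F grad]) auto
    note measurable_compose[OF meas borel_measurable_norm]
    then have "{x \<in> space (lborel \<Otimes>\<^sub>M D). norm (dF (?l (fst x)) (snd x)) \<le> G} \<in> sets (lborel \<Otimes>\<^sub>M D)"
      by (intro borel_measurable_le) auto
    \<comment> \<open>By Fubini, for almost every \<open>z\<close> the bound holds at almost every
      point of the segment.\<close>
    then have "AE z in D. AE t in lborel. norm (dF (?l t) z) \<le> G"
      using bound by (subst P.AE_commute[symmetric]) auto
    then show ?thesis using AE_space
    proof eventually_elim
      case (elim z)
      from elim(1) obtain N where N: "{t. \<not> norm (dF (?l t) z) \<le> G} \<subseteq> N" "N \<in> null_sets lborel"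
        by (auto simp: eventually_ae_filter)
      have neg: "negligible N"
        using N(2) by (simp add: negligible_iff_null_sets null_sets_completionI)
      let ?d = "\<lambda>t. (q - p) \<bullet> dF (?l t) z"
      have "((\<lambda>t. F (?l t) z) has_vector_derivative ?d t) (at t within {0..1})" for t
        using GDERIV_line[OF grad[OF elim(2)]]
        by (simp add: has_real_derivative_iff_has_vector_derivative has_vector_derivative_at_within)
      then have "(?d has_integral (F (?l 1) z - F (?l 0) z)) {0..1}"
        by (intro fundamental_theorem_of_calculus) auto
      \<comment> \<open>Setting the derivative to zero on the null set \<open>N\<close> keeps the
        integral and makes the bound hold for every \<open>t\<close>.\<close>
      then have "((\<lambda>t. if t \<in> N then 0 else ?d t) has_integral (F q z - F p z)) {0..1}"
        by (intro has_integral_spike[OF neg _, of _ "\<lambda>t. if t \<in> N then 0 else ?d t" ?d]) auto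
      moreover have "norm (if t \<in> N then 0 else ?d t) \<le> G * norm (q - p)" for t
      proof (cases "t \<in> N")
        case False
        then have "norm (dF (?l t) z) \<le> G" using N(1) by blast
        then have "norm (q - p) * norm (dF (?l t) z) \<le> norm (q - p) * G"
          by (intro mult_left_mono) auto
        then show ?thesis using False Cauchy_Schwarz_ineq2[of "q - p" "dF (?l t) z"]
          by (simp add: mult.commute)
      qed (simp add: G)
      ultimately have "norm (F q z - F p z) \<le> G * norm (q - p) * measure lborel {0..1::real}"
        using G by (intro has_integral_bound_real[where f = "\<lambda>t. if t \<in> N then 0 else ?d t"]) auto
      then show ?case by simp
    qed
  qed
  obtain Q :: "(real ^ 'd) set" where Q: "countable Q" "\<And>U. open U \<Longrightarrow> U \<noteq> {} \<Longrightarrow> \<exists>y\<in>Q. y \<in> U"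
    using countable_dense_exists by blast
  have dense: "closure Q = UNIV"
    using Q(2)[of "- closure Q"] closure_subset[of Q] by blast
  have "AE z in D. \<forall>p\<in>Q. \<forall>q\<in>Q. \<bar>F q z - F p z\<bar> \<le> G * norm (q - p)"
    using Q(1) seg by (simp add: AE_ball_countable)
  then show ?thesis using AE_space
  proof eventually_elim
    case (elim z)
    have cont: "continuous_on UNIV (\<lambda>y. F y z)"
      using GDERIV_imp_continuous[OF grad[OF elim(2)]] by (simp add: continuous_on_eq_continuous_at)
    \<comment> \<open>The Lipschitz inequality is a closed condition on the pair of points, so it
      extends from the dense set \<open>Q \<times> Q\<close> to all pairs.\<close>
    let ?S = "{x. \<bar>F (snd x) z - F (fst x) z\<bar> \<le> G * norm (snd x - fst x)}"
    have "closed ?S"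
      by (intro closed_Collect_le continuous_intros continuous_on_compose2[OF cont]) auto
    moreover have "Q \<times> Q \<subseteq> ?S" using elim(1) by auto
    ultimately have "closure (Q \<times> Q) \<subseteq> ?S" by (rule closure_minimal[rotated])
    then have sub: "UNIV \<subseteq> ?S" by (simp only: closure_Times dense UNIV_Times_UNIV)
    have lip: "\<bar>F y' z - F y z\<bar> \<le> G * norm (y' - y)" for y y'
      using subsetD[OF sub UNIV_I, of "(y, y')"] by simp
    show ?case
    proof
      fix y
      \<comment> \<open>The direction is the gradient itself, along which the directional derivative
        is its squared norm.\<close>
      let ?h = "dF y z" and ?r = "\<lambda>n. inverse (real (Suc n))"
      have "(\<lambda>n. \<bar>(F (y + ?r n *\<^sub>R ?h) z - F y z) / ?r n\<bar>) \<longlonglongrightarrow> \<bar>?h \<bullet> ?h\<bar>"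
        by (intro tendsto_rabs GDERIV_difference_quotient grad elim)
      moreover have "\<bar>(F (y + ?r n *\<^sub>R ?h) z - F y z) / ?r n\<bar> \<le> G * norm ?h" for n
        using lip[of "y + ?r n *\<^sub>R ?h" y] by (simp add: divide_le_eq mult.commute mult.left_commute del: of_nat_Suc)
      ultimately have "\<bar>?h \<bullet> ?h\<bar> \<le> G * norm ?h"
        by (intro LIMSEQ_le_const2) auto
      then have "norm ?h * norm ?h \<le> G * norm ?h"
        by (simp add: power2_norm_eq_inner[symmetric] power2_eq_square)
      then show "norm ?h \<le> G" using G by (cases "?h = 0") auto
    qed
  qed
qed

subsection \<open>The iterates\<close>

text \<open>The averaging matrix annihilates vectors of sum zero. There \<open>A\<close> acts as the
  symmetric matrix \<open>A - averaging_matrix\<close>, which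
  \<open>symmetric_matrix_norm_le\<close> controls by its spectral radius.\<close>

lemma mixing_matrix_of_doubly_stochastic:
  fixes A :: "real ^ 'n::finite ^ 'n"
  defines "r \<equiv> matrix_spectral_radius (A - averaging_matrix)"
  assumes sym: "transpose A = A" and ds: "doubly_stochastic A" and r: "r < 1"
  shows "mixing_matrix (\<lambda>i j. A $ i $ j) r"
proof
  let ?B = "A - averaging_matrix"
  have "A $ j $ i = A $ i $ j" for i j
    using sym by (simp add: transpose_def Finite_Cartesian_Product.vec_eq_iff)
  then have "transpose ?B = ?B"
    by (simp add: transpose_def averaging_matrix_def Finite_Cartesian_Product.vec_eq_iff)
  note le = symmetric_matrix_norm_le[OF this, folded r_def]
  show "0 \<le> A $ i $ j" "(\<Sum>j\<in>UNIV. A $ i $ j) = 1" "(\<Sum>i\<in>UNIV. A $ i $ j) = 1" for i j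
    using ds by (simp_all add: doubly_stochastic_def)
  show "r < 1" by fact
  have "0 \<le> norm (?B *v axis undefined 1)" by simp
  also have "\<dots> \<le> r" using le[of "axis undefined 1"] by (simp add: norm_axis_1)
  finally show "0 \<le> r" .
  fix x :: "'n \<Rightarrow> real" assume x: "(\<Sum>i\<in>UNIV. x i) = 0"
  have "(?B *v (\<chi> i. x i)) $ i = (\<Sum>j\<in>UNIV. A $ i $ j * x j)" for i
    using x by (simp add: matrix_vector_mult_def averaging_matrix_def left_diff_distrib
        sum_subtractf flip: sum_divide_distrib)
  then have "(\<Sum>i\<in>UNIV. (\<Sum>j\<in>UNIV. A $ i $ j * x j)\<^sup>2) = (norm (?B *v (\<chi> i. x i)))\<^sup>2"
    by (simp add: norm_vec_def L2_set_def sum_nonneg)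
  also have "\<dots> \<le> (r * norm (\<chi> i. x i))\<^sup>2"
    by (intro power_mono le) simp
  also have "\<dots> = r\<^sup>2 * (\<Sum>i\<in>UNIV. (x i)\<^sup>2)"
    by (simp add: power_mult_distrib norm_vec_def L2_set_def sum_nonneg)
  finally show "(\<Sum>i\<in>UNIV. (\<Sum>j\<in>UNIV. A $ i $ j * x j)\<^sup>2) \<le> r\<^sup>2 * (\<Sum>i\<in>UNIV. (x i)\<^sup>2)" .
qed

section \<open>Consensus error along a sample path\<close>

definition consensus_error :: "('n::finite \<Rightarrow> real ^ 'd::finite) \<Rightarrow> real" where
  "consensus_error w = (norm (stack w - stacked_average w))\<^sup>2"

lemma consensus_error_eq: "consensus_error w = (\<Sum>k\<in>UNIV. deviation (\<lambda>i. w i $ k))"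
proof -
  have "consensus_error w = (\<Sum>i\<in>UNIV. \<Sum>k\<in>UNIV. (w i $ k - avg (\<lambda>i. w i $ k))\<^sup>2)"
    by (simp add: consensus_error_def norm_vec_def L2_set_def sum_nonneg stack_def
        stacked_average_def node_average_def avg_def)
  also have "\<dots> = (\<Sum>k\<in>UNIV. deviation (\<lambda>i. w i $ k))"
    unfolding deviation_def by (rule sum.swap)
  finally show ?thesis .
qed

text \<open>Mixing, squaring and clipping act coordinate by coordinate, so the scalar estimate is
  applied to each coordinate divided by \<open>G\<close> and the results are summed.\<close>

lemma consensus_error_pathwise:
  fixes A :: "real ^ 'n::finite ^ 'n" and x m v s :: "nat \<Rightarrow> 'n \<Rightarrow> real ^ 'd::finite"
  assumes mix: "mixing_matrix (\<lambda>i j. A $ i $ j) \<rho>"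
    and iter: "gt_adaptive_iterates A \<alpha> \<beta>1 \<beta>2 vmin vmax x1 h x m v s"
    and G: "0 < G" and bounded: "\<And>t i. 1 \<le> t \<Longrightarrow> norm (h t i (x t i)) \<le> G"
    and \<beta>2: "0 < \<beta>2" "\<beta>2 < 1"
  shows "(\<Sum>t=1..T. consensus_error (v t))
    \<le> 36 * G\<^sup>2 / (1 - \<rho>)\<^sup>2 * (\<Sum>t=1..T. consensus_error (s t))
      + 2 / (1 - \<beta>2\<^sup>2) * consensus_error (v 1)"
proof -
  have init: "s 1 i = h 1 i (x 1 i)" for i
    using iter by (simp add: gt_adaptive_iterates_def)
  have v_step: "v (t + 1) i = clip vmin vmax (\<beta>2 *\<^sub>R v t i + (1 - \<beta>2) *\<^sub>R (s t i * s t i))"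
    and s_step: "s (t + 1) i = (\<Sum>j\<in>UNIV. A $ i $ j *\<^sub>R s t j)
                      + h (t + 1) i (x (t + 1) i) - h t i (x t i)" if "1 \<le> t" for t i
    using iter that by (simp_all add: gt_adaptive_iterates_def)
  have coord: "(\<Sum>t=1..T. deviation (\<lambda>i. v t i $ k))
    \<le> 36 * G\<^sup>2 / (1 - \<rho>)\<^sup>2 * (\<Sum>t=1..T. deviation (\<lambda>i. s t i $ k))
      + 2 / (1 - \<beta>2\<^sup>2) * deviation (\<lambda>i. v 1 i $ k)" for k
  proof -
    define s' where "s' = (\<lambda>t i. s t i $ k / G)"
    define g' where "g' = (\<lambda>t i. h t i (x t i) $ k / G)"
    interpret M: mixing_matrix "\<lambda>i j. A $ i $ j" \<rho> by fact
    interpret tracking "\<lambda>i j. A $ i $ j" \<rho> s' g'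
    proof
      show "s' 1 i = g' 1 i" for i by (simp only: s'_def g'_def init)
      show "s' (t + 1) i = M.mix (s' t) i + g' (t + 1) i - g' t i" if "1 \<le> t" for t i
        unfolding s'_def g'_def s_step[OF that]
        by (simp add: M.mix_def add_divide_distrib diff_divide_distrib sum_divide_distrib)
      show "\<bar>g' t i\<bar> \<le> 1" if "1 \<le> t" for t i
        using order_trans[OF component_le_norm_cart bounded[OF that]] G by (simp add: g'_def)
    qed
    have s_eq: "(\<lambda>i. s t i $ k) = (\<lambda>i. G * s' t i)" for t
      using G by (simp add: s'_def)
    have sq: "(\<Sum>t=1..T. deviation (\<lambda>i. (s t i $ k)\<^sup>2))
      \<le> 36 * G\<^sup>2 / (1 - \<rho>)\<^sup>2 * (\<Sum>t=1..T. deviation (\<lambda>i. s t i $ k))"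
    proof -
      \<comment> \<open>The deviation of the squares scales by G^4, that of \<open>s\<close> by G^2;
        one factor G^2 remains in the constant.\<close>
      have "(\<Sum>t=1..T. deviation (\<lambda>i. (s t i $ k)\<^sup>2)) = (G\<^sup>2)\<^sup>2 * (\<Sum>t=1..T. deviation (\<lambda>i. (s' t i)\<^sup>2))"
        unfolding fun_cong[OF s_eq] power_mult_distrib deviation_scale sum_distrib_left ..
      also have "\<dots> \<le> (G\<^sup>2)\<^sup>2 * (36 / (1 - \<rho>)\<^sup>2 * (\<Sum>t=1..T. deviation (s' t)))"
        by (intro mult_left_mono sum_deviation_sq_le) simp
      also have "\<dots> = 36 * G\<^sup>2 / (1 - \<rho>)\<^sup>2 * (\<Sum>t=1..T. deviation (\<lambda>i. s t i $ k))"
        unfolding s_eq deviation_scale by (simp add: power2_eq_square flip: sum_distrib_left)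
      finally show ?thesis .
    qed
    have "deviation (\<lambda>i. v (t + 1) i $ k)
        \<le> \<beta>2 * deviation (\<lambda>i. v t i $ k) + (1 - \<beta>2) * deviation (\<lambda>i. (s t i $ k)\<^sup>2)" if "1 \<le> t" for t
    proof -
      have "(\<lambda>i. v (t + 1) i $ k)
          = (\<lambda>i. max (min (\<beta>2 * (v t i $ k) + (1 - \<beta>2) * (s t i $ k)\<^sup>2) vmax) vmin)"
        unfolding v_step[OF that] by (simp add: clip_def times_vec_def power2_eq_square)
      then show ?thesis
        using \<beta>2 by (auto intro: order_trans[OF deviation_clip deviation_convex])
    qed
    then have "(\<Sum>t=1..T. deviation (\<lambda>i. v t i $ k))
        \<le> deviation (\<lambda>i. v 1 i $ k) / (1 - \<beta>2) + (\<Sum>t=1..T. deviation (\<lambda>i. (s t i $ k)\<^sup>2))"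
      using \<beta>2 by (intro sum_smoothed_le) (auto simp: deviation_nonneg)
    also have "deviation (\<lambda>i. v 1 i $ k) / (1 - \<beta>2) \<le> 2 / (1 - \<beta>2\<^sup>2) * deviation (\<lambda>i. v 1 i $ k)"
    proof -
      \<comment> \<open>The constant 2 comes from 1 + \<beta>2 \<le> 2.\<close>
      have "1 - \<beta>2\<^sup>2 = (1 - \<beta>2) * (1 + \<beta>2)" by (simp add: power2_eq_square algebra_simps)
      then have "1 / (1 - \<beta>2) \<le> 2 / (1 - \<beta>2\<^sup>2)"
        using \<beta>2 by (simp add: divide_simps)
      then show ?thesis
        using mult_right_mono[OF _ deviation_nonneg] by fastforce
    qed
    finally show ?thesis using sq by linarith
  qed
  have "(\<Sum>t=1..T. consensus_error (v t)) = (\<Sum>k\<in>UNIV. \<Sum>t=1..T. deviation (\<lambda>i. v t i $ k))"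
    unfolding consensus_error_eq by (rule sum.swap)
  also have "\<dots> \<le> (\<Sum>k\<in>UNIV. 36 * G\<^sup>2 / (1 - \<rho>)\<^sup>2 * (\<Sum>t=1..T. deviation (\<lambda>i. s t i $ k))
      + 2 / (1 - \<beta>2\<^sup>2) * deviation (\<lambda>i. v 1 i $ k))"
    by (intro sum_mono coord)
  also have "\<dots> = 36 * G\<^sup>2 / (1 - \<rho>)\<^sup>2 * (\<Sum>k\<in>UNIV. \<Sum>t=1..T. deviation (\<lambda>i. s t i $ k))
      + 2 / (1 - \<beta>2\<^sup>2) * consensus_error (v 1)"
    by (simp only: sum.distrib sum_distrib_left consensus_error_eq)
  also have "(\<Sum>k\<in>UNIV. \<Sum>t=1..T. deviation (\<lambda>i. s t i $ k)) = (\<Sum>t=1..T. consensus_error (s t))"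
    unfolding consensus_error_eq by (rule sum.swap)
  finally show ?thesis .
qed

lemma diag_inv_sqrt_mult_nth:
  fixes w y :: "real ^ 'd::finite"
  shows "(diag_inv_sqrt w *v y) $ k = (w $ k) powr (- 1 / 2) * y $ k"
  by (simp add: diag_inv_sqrt_def diag_matrix_def matrix_vector_mult_def mult_delta_left)

section \<open>Measurability and integrability of the iterates\<close>

text \<open>The induction step follows the order of dependence m, v, x, s. The recursion is known on
  \<open>space M\<close>, where \<open>measurable_cong\<close> replaces each iterate by its
  update.\<close>

lemma measurable_iterates:
  fixes A :: "real ^ 'n::finite ^ 'n" and x m v s :: "nat \<Rightarrow> 'n \<Rightarrow> 'a \<Rightarrow> real ^ 'd::finite"
  assumes iter: "\<And>\<omega>. \<omega> \<in> space M \<Longrightarrow>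
      gt_adaptive_iterates A \<alpha> \<beta>1 \<beta>2 vmin vmax x1 (\<lambda>t i. h t i \<omega>)
        (\<lambda>t i. x t i \<omega>) (\<lambda>t i. m t i \<omega>) (\<lambda>t i. v t i \<omega>) (\<lambda>t i. s t i \<omega>)"
    and h: "\<And>t i X. 1 \<le> t \<Longrightarrow> X \<in> borel_measurable M \<Longrightarrow> (\<lambda>\<omega>. h t i \<omega> (X \<omega>)) \<in> borel_measurable M"
    and "1 \<le> t"
  shows "(\<forall>i. x t i \<in> borel_measurable M) \<and> (\<forall>i. m t i \<in> borel_measurable M)
    \<and> (\<forall>i. v t i \<in> borel_measurable M) \<and> (\<forall>i. s t i \<in> borel_measurable M)"
  using \<open>1 \<le> t\<close>
proof (induction t rule: dec_induct)
  case base
  note init = iter[unfolded gt_adaptive_iterates_def, THEN conjunct1, rule_format]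
  have x: "x 1 i \<in> borel_measurable M" for i
    by (subst measurable_cong[where g = "\<lambda>_. x1 i"]) (auto simp: init simp del: One_nat_def)
  have s: "s 1 i \<in> borel_measurable M" for i
    by (subst measurable_cong[where g = "\<lambda>\<omega>. h 1 i \<omega> (x 1 i \<omega>)"])
      (auto simp: init simp del: One_nat_def intro!: h x)
  have m: "m 1 i \<in> borel_measurable M" for i
    by (subst measurable_cong[where g = "\<lambda>_. 0"]) (auto simp: init simp del: One_nat_def)
  have "(\<lambda>\<omega>. s 1 i \<omega> * s 1 i \<omega>) \<in> borel_measurable M" for i
    by (rule borel_measurable_vecI) (simp add: times_vec_def borel_measurable_times[OF borel_measurable_vec_nth borel_measurable_vec_nth] s[unfolded One_nat_def])
  then have v: "v 1 i \<in> borel_measurable M" for i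
    by (subst measurable_cong[where g = "\<lambda>\<omega>. s 1 i \<omega> * s 1 i \<omega>"]) (auto simp: init simp del: One_nat_def)
  show ?case using x m v s by blast
next
  case (step t)
  then have t: "1 \<le> t" "1 \<le> t + 1" by auto
  note upd = iter[unfolded gt_adaptive_iterates_def, THEN conjunct2, rule_format, OF _ t(1)]
  have IH [measurable]: "x t i \<in> borel_measurable M" "m t i \<in> borel_measurable M"
    "v t i \<in> borel_measurable M" "s t i \<in> borel_measurable M" for i
    using step.IH by auto
  note nth [measurable] = IH[THEN borel_measurable_vec_nth]
  have m: "m (t + 1) i \<in> borel_measurable M" for i
    by (subst measurable_cong[where g = "\<lambda>\<omega>. \<beta>1 *\<^sub>R m t i \<omega> + (1 - \<beta>1) *\<^sub>R s t i \<omega>"], simp only: upd) measurable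
  have "(\<lambda>\<omega>. clip vmin vmax (\<beta>2 *\<^sub>R v t i \<omega> + (1 - \<beta>2) *\<^sub>R (s t i \<omega> * s t i \<omega>))) \<in> borel_measurable M" for i
    by (rule borel_measurable_vecI) (simp add: clip_def times_vec_def)
  note [measurable] = this
  have v: "v (t + 1) i \<in> borel_measurable M" for i
    by (subst measurable_cong[where g = "\<lambda>\<omega>. clip vmin vmax (\<beta>2 *\<^sub>R v t i \<omega> + (1 - \<beta>2) *\<^sub>R (s t i \<omega> * s t i \<omega>))"], simp only: upd) measurable
  note [measurable] = m[THEN borel_measurable_vec_nth] v[THEN borel_measurable_vec_nth]
  have [measurable]: "(\<lambda>\<omega>. diag_inv_sqrt (v (t + 1) i \<omega>) *v m (t + 1) i \<omega>) \<in> borel_measurable M" for i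
    by (rule borel_measurable_vecI, simp only: diag_inv_sqrt_mult_nth) measurable
  have x: "x (t + 1) i \<in> borel_measurable M" for i
    by (subst measurable_cong[where g = "\<lambda>\<omega>. (\<Sum>j\<in>UNIV. A $ i $ j *\<^sub>R x t j \<omega>)
                      - \<alpha> *\<^sub>R (diag_inv_sqrt (v (t + 1) i \<omega>) *v m (t + 1) i \<omega>)"], simp only: upd) measurable
  note [measurable] = h[OF t(2) x] h[OF t(1) IH(1)]
  have s: "s (t + 1) i \<in> borel_measurable M" for i
    by (subst measurable_cong[where g = "\<lambda>\<omega>. (\<Sum>j\<in>UNIV. A $ i $ j *\<^sub>R s t j \<omega>)
                      + h (t + 1) i \<omega> (x (t + 1) i \<omega>) - h t i \<omega> (x t i \<omega>)"], simp only: upd) measurable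
  show ?case using x m v s by simp
qed

text \<open>These bounds serve integrability at each fixed time, so the one for \<open>s\<close> may
  grow with \<open>t\<close>: mixing keeps it, and the two gradients add at most
  \<open>2 * G\<close> per step.\<close>

lemma bounded_iterates:
  fixes A :: "real ^ 'n::finite ^ 'n" and x m v s :: "nat \<Rightarrow> 'n \<Rightarrow> real ^ 'd::finite"
  assumes mix: "mixing_matrix (\<lambda>i j. A $ i $ j) \<rho>"
    and iter: "gt_adaptive_iterates A \<alpha> \<beta>1 \<beta>2 vmin vmax x1 h x m v s"
    and bounded: "\<And>t i. 1 \<le> t \<Longrightarrow> norm (h t i (x t i)) \<le> G" and t: "1 \<le> t"
  shows "\<bar>s t i $ k\<bar> \<le> 2 * real t * G"
    and "\<bar>v t i $ k\<bar> \<le> G\<^sup>2 + \<bar>vmin\<bar> + \<bar>vmax\<bar>"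
proof -
  interpret mixing_matrix "\<lambda>i j. A $ i $ j" \<rho> by fact
  have g: "\<bar>h t i (x t i) $ k\<bar> \<le> G" if "1 \<le> t" for t i
    using order_trans[OF component_le_norm_cart bounded[OF that]] .
  have init: "s 1 i = h 1 i (x 1 i)" "v 1 i = s 1 i * s 1 i" for i
    using iter by (simp_all add: gt_adaptive_iterates_def)
  show "\<bar>s t i $ k\<bar> \<le> 2 * real t * G" using t
  proof (induction t arbitrary: i rule: dec_induct)
    case base
    have "\<bar>h 1 i (x 1 i) $ k\<bar> \<le> G" by (rule g) simp
    then show ?case by (simp only: init)
  next
    case (step t)
    have "s (t + 1) i $ k = mix (\<lambda>j. s t j $ k) i + h (t + 1) i (x (t + 1) i) $ k - h t i (x t i) $ k"
      using iter step by (simp add: gt_adaptive_iterates_def mix_def)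
    moreover have "\<bar>mix (\<lambda>j. s t j $ k) i\<bar> \<le> mix (\<lambda>_. 2 * real t * G) i"
      using step by (intro order_trans[OF abs_mix_le] mix_mono) auto
    ultimately have "\<bar>s (t + 1) i $ k\<bar> \<le> 2 * real t * G + 2 * G"
      using g[of "t + 1" i] g[of t i] step by (simp add: mix_const)
    then show ?case by (simp add: algebra_simps)
  qed
  show "\<bar>v t i $ k\<bar> \<le> G\<^sup>2 + \<bar>vmin\<bar> + \<bar>vmax\<bar>"
  \<comment> \<open>\<open>v 1\<close> is not clipped; it is bounded through the first
    gradient.\<close>
  proof (cases "t = 1")
    case True
    have "\<bar>h 1 i (x 1 i) $ k\<bar>\<^sup>2 \<le> G\<^sup>2" by (intro power_mono g) auto
    then have "\<bar>v 1 i $ k\<bar> \<le> G\<^sup>2" by (simp only: init) (simp add: times_vec_def power2_eq_square)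
    then show ?thesis using True by simp
  next
    case False
    define u where "u = t - 1"
    have u: "t = u + 1" "1 \<le> u" using t False by (auto simp: u_def)
    have "\<bar>v t i $ k\<bar> \<le> \<bar>vmin\<bar> + \<bar>vmax\<bar>"
      using iter u by (simp add: gt_adaptive_iterates_def clip_def)
    moreover have "0 \<le> G\<^sup>2" by simp
    ultimately show ?thesis by linarith
  qed
qed

lemma (in finite_measure) integrable_consensus_error:
  fixes w :: "'n::finite \<Rightarrow> 'a \<Rightarrow> real ^ 'd::finite"
  assumes w: "\<And>i. w i \<in> borel_measurable M" and bound: "AE \<omega> in M. \<forall>i k. \<bar>w i \<omega> $ k\<bar> \<le> C"
  shows "integrable M (\<lambda>\<omega>. consensus_error (\<lambda>i. w i \<omega>))"
proof (rule integrable_const_bound)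
  note [measurable] = w[THEN borel_measurable_vec_nth]
  show "(\<lambda>\<omega>. consensus_error (\<lambda>i. w i \<omega>)) \<in> borel_measurable M"
    unfolding consensus_error_eq deviation_def avg_def by measurable
  show "AE \<omega> in M. norm (consensus_error (\<lambda>i. w i \<omega>)) \<le> (\<Sum>k\<in>(UNIV::'d set). \<Sum>i\<in>(UNIV::'n set). C\<^sup>2)"
    using bound
  proof eventually_elim
    case (elim \<omega>)
    have "consensus_error (\<lambda>i. w i \<omega>) \<le> (\<Sum>k\<in>UNIV. \<Sum>i\<in>UNIV. (w i \<omega> $ k)\<^sup>2)"
      unfolding consensus_error_eq using deviation_le[where c = 0] by (intro sum_mono) simp
    also have "\<dots> \<le> (\<Sum>k\<in>(UNIV::'d set). \<Sum>i\<in>(UNIV::'n set). C\<^sup>2)"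
      using elim by (intro sum_mono) (metis abs_ge_zero power2_abs power_mono)
    finally show ?case by (simp add: consensus_error_def)
  qed
qed

section \<open>Passage to expectations\<close>

theorem lemma5:
  fixes M :: "'a measure"
    and D :: "'n::finite \<Rightarrow> 'b measure"
    and \<xi> :: "nat \<Rightarrow> 'n \<Rightarrow> 'a \<Rightarrow> 'b"
    and F :: "'n \<Rightarrow> real ^ 'd::finite \<Rightarrow> 'b \<Rightarrow> real"
    and f :: "'n \<Rightarrow> real ^ 'd \<Rightarrow> real"
    and dF :: "'n \<Rightarrow> real ^ 'd \<Rightarrow> 'b \<Rightarrow> real ^ 'd"
    and E :: "'n rel"
    and A :: "real ^ 'n ^ 'n"
    and x1 :: "'n \<Rightarrow> real ^ 'd"
    and x m v s :: "nat \<Rightarrow> 'n \<Rightarrow> 'a \<Rightarrow> real ^ 'd"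
    and \<alpha> \<beta>1 \<beta>2 vmin vmax G \<rho>A :: real
    and T :: nat
  assumes "prob_space M"
    and "stochastic_costs D F f dF"
    and "fresh_samples M D \<xi>"
    and "0 < \<beta>1" "\<beta>1 < 1" "0 < \<beta>2" "\<beta>2 < 1" "0 < \<alpha>"
    and "0 < vmin" "vmin \<le> 1" "1 \<le> vmax"
    and "weighted_adjacency E A"
    and "\<And>\<omega>. \<omega> \<in> space M \<Longrightarrow>
           gt_adaptive_iterates A \<alpha> \<beta>1 \<beta>2 vmin vmax x1 (\<lambda>t i y. dF i y (\<xi> t i \<omega>))
             (\<lambda>t i. x t i \<omega>) (\<lambda>t i. m t i \<omega>) (\<lambda>t i. v t i \<omega>) (\<lambda>t i. s t i \<omega>)"
    and "0 < G"
    and "\<And>i y. AE z in D i. norm (dF i y z) \<le> G"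
    and "connected_graph E"
    and "doubly_stochastic A"
    and "\<rho>A = matrix_spectral_radius (A - averaging_matrix)"
    and "\<rho>A < 1"
    and "1 \<le> T"
  shows "(\<Sum>t=1..T. \<integral>\<omega>. (norm (stack (\<lambda>i. v t i \<omega>) - stacked_average (\<lambda>i. v t i \<omega>)))\<^sup>2 \<partial>M)
    \<le> 36 * G\<^sup>2 / (1 - \<rho>A)\<^sup>2 *
        (\<Sum>t=1..T. \<integral>\<omega>. (norm (stack (\<lambda>i. s t i \<omega>) - stacked_average (\<lambda>i. s t i \<omega>)))\<^sup>2 \<partial>M)
      + 2 / (1 - \<beta>2\<^sup>2) *
        (\<integral>\<omega>. (norm (stack (\<lambda>i. v 1 i \<omega>) - stacked_average (\<lambda>i. v 1 i \<omega>)))\<^sup>2 \<partial>M)"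
proof -
  note fresh = assms(3) and iter = assms(13)
  interpret prob_space M by fact
  have D: "prob_space (D i)" and F: "F i y \<in> borel_measurable (D i)"
    and grad: "z \<in> space (D i) \<Longrightarrow> GDERIV (\<lambda>y. F i y z) y :> dF i y z" for i y z
    using assms(2) by (auto simp: stochastic_costs_def has_bochner_integral_iff)
  have xi: "\<xi> t i \<in> measurable M (D i)" and law: "distr M (D i) (\<xi> t i) = D i" if "1 \<le> t" for t i
    using fresh that by (auto simp: fresh_samples_def)
  have mix: "mixing_matrix (\<lambda>i j. A $ i $ j) \<rho>A"
    using assms by (auto simp: weighted_adjacency_def intro: mixing_matrix_of_doubly_stochastic)
  \<comment> \<open>The bound holds almost surely under \<open>D i\<close> for all \<open>y\<close>
    at once and is pulled back along the sample, whose law is \<open>D i\<close>.\<close>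
  have "AE \<omega> in M. \<forall>y. norm (dF i y (\<xi> t i \<omega>)) \<le> G" if "1 \<le> t" for t i
  proof -
    have "AE z in D i. \<forall>y. norm (dF i y z) \<le> G"
      using D F grad less_imp_le[OF \<open>0 < G\<close>] assms(15) by (rule AE_gradient_norm_le)
    then have "AE z in distr M (D i) (\<xi> t i). \<forall>y. norm (dF i y z) \<le> G"
      by (simp only: law[OF that])
    with xi[OF that] show ?thesis by (rule AE_distrD)
  qed
  \<comment> \<open>Times are countable and nodes finite, so one null set serves all of
    them.\<close>
  then have "AE \<omega> in M. \<forall>t i. 1 \<le> t \<longrightarrow> (\<forall>y. norm (dF i y (\<xi> t i \<omega>)) \<le> G)"
    by (simp add: AE_all_countable)
  then have ae: "AE \<omega> in M. \<omega> \<in> space M \<and> (\<forall>t i y. 1 \<le> t \<longrightarrow> norm (dF i y (\<xi> t i \<omega>)) \<le> G)"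
    using AE_space by eventually_elim blast
  have meas: "(\<forall>i. x t i \<in> borel_measurable M) \<and> (\<forall>i. m t i \<in> borel_measurable M)
    \<and> (\<forall>i. v t i \<in> borel_measurable M) \<and> (\<forall>i. s t i \<in> borel_measurable M)" if "1 \<le> t" for t
    using that by (intro measurable_iterates[OF iter] measurable_gradient[OF F grad] xi)
  have int_s: "integrable M (\<lambda>\<omega>. consensus_error (\<lambda>i. s t i \<omega>))" if "1 \<le> t" for t
  proof (rule integrable_consensus_error)
    show "AE \<omega> in M. \<forall>i k. \<bar>s t i \<omega> $ k\<bar> \<le> 2 * real t * G"
      using ae by eventually_elim (use that in \<open>auto intro!: bounded_iterates(1)[OF mix iter]\<close>)
  qed (use meas[OF that] in blast)
  have int_v: "integrable M (\<lambda>\<omega>. consensus_error (\<lambda>i. v t i \<omega>))" if "1 \<le> t" for t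
  proof (rule integrable_consensus_error)
    show "AE \<omega> in M. \<forall>i k. \<bar>v t i \<omega> $ k\<bar> \<le> G\<^sup>2 + \<bar>vmin\<bar> + \<bar>vmax\<bar>"
      using ae by eventually_elim (use that in \<open>auto intro!: bounded_iterates(2)[OF mix iter]\<close>)
  qed (use meas[OF that] in blast)
  have "integrable M (\<lambda>\<omega>. \<Sum>t=1..T. consensus_error (\<lambda>i. s t i \<omega>))"
    using int_s by (intro Bochner_Integration.integrable_sum) auto
  note scaled = integrable_mult_right[OF this, of "36 * G\<^sup>2 / (1 - \<rho>A)\<^sup>2"]
    integrable_mult_right[OF int_v[OF order_refl], of "2 / (1 - \<beta>2\<^sup>2)"]
  have "(\<Sum>t=1..T. \<integral>\<omega>. consensus_error (\<lambda>i. v t i \<omega>) \<partial>M)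
      = (\<integral>\<omega>. (\<Sum>t=1..T. consensus_error (\<lambda>i. v t i \<omega>)) \<partial>M)"
    using int_v by (intro Bochner_Integration.integral_sum[symmetric]) auto
  also have "\<dots> \<le> (\<integral>\<omega>. 36 * G\<^sup>2 / (1 - \<rho>A)\<^sup>2 * (\<Sum>t=1..T. consensus_error (\<lambda>i. s t i \<omega>))
      + 2 / (1 - \<beta>2\<^sup>2) * consensus_error (\<lambda>i. v 1 i \<omega>) \<partial>M)"
  proof (rule integral_mono_AE)
    show "AE \<omega> in M. (\<Sum>t=1..T. consensus_error (\<lambda>i. v t i \<omega>))
      \<le> 36 * G\<^sup>2 / (1 - \<rho>A)\<^sup>2 * (\<Sum>t=1..T. consensus_error (\<lambda>i. s t i \<omega>))
        + 2 / (1 - \<beta>2\<^sup>2) * consensus_error (\<lambda>i. v 1 i \<omega>)"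
      using ae
    proof eventually_elim
      case (elim \<omega>)
      then show ?case
        using assms by (intro consensus_error_pathwise[OF mix iter]) auto
    qed
    show "integrable M (\<lambda>\<omega>. 36 * G\<^sup>2 / (1 - \<rho>A)\<^sup>2 * (\<Sum>t=1..T. consensus_error (\<lambda>i. s t i \<omega>))
      + 2 / (1 - \<beta>2\<^sup>2) * consensus_error (\<lambda>i. v 1 i \<omega>))"
      by (rule Bochner_Integration.integrable_add[OF scaled])
  qed (use int_v in auto)
  also have "\<dots> = 36 * G\<^sup>2 / (1 - \<rho>A)\<^sup>2 * (\<Sum>t=1..T. \<integral>\<omega>. consensus_error (\<lambda>i. s t i \<omega>) \<partial>M)
      + 2 / (1 - \<beta>2\<^sup>2) * (\<integral>\<omega>. consensus_error (\<lambda>i. v 1 i \<omega>) \<partial>M)"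
  proof -
    have "(\<integral>\<omega>. (\<Sum>t=1..T. consensus_error (\<lambda>i. s t i \<omega>)) \<partial>M)
        = (\<Sum>t=1..T. \<integral>\<omega>. consensus_error (\<lambda>i. s t i \<omega>) \<partial>M)"
      using int_s by (intro Bochner_Integration.integral_sum) auto
    then show ?thesis
      unfolding Bochner_Integration.integral_add[OF scaled] integral_mult_right_zero by simp
  qed
  finally show ?thesis unfolding consensus_error_def .
qed

end
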